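(* Let $n\in\mathbb N$, let $r\in\mathbb N\cup\{0\}$, and let $t$ be an integer with $t\mid r$. Then the group $\mathcal F_n(r,t)$ (defined in the context) is a representation group of $(\mathbb Z/r\mathbb Z)^n\oplus\mathbb Z/t\mathbb Z$.
   Context: $\mathbb N$ denotes the positive integers; $\mathbb Z/0\mathbb Z=\mathbb Z$; $[x,y]=xyx^{-1}y^{-1}$. The group $\mathcal F_n(r,t)$ is given by the presentation with generators $x_k$ ($1\le k\le n+1$) and $z_{ij}$ ($1\le i<j\le n+1$) and relations $$[x_i,x_j]=z_{ij}\quad(1\le i<j\le n+1),\qquad x_1^t=1,\qquad x_j^r=1\quad(2\le j\le n+1),$$ together with the (conventionally omitted) relations that the elements $z_{ij}$ commute with each other and with all $x_k$, i.e. the $z_{ij}$ are central. A relation with exponent $0$ is vacuous. All groups are considered as abstract (discrete) groups, and $\mathrm H^2(G,\mathbb C^\times)$ is taken with trivial action of $G$ on $\mathbb C^\times$. A group $G^*$ is a representation group of $G$ if there is a central extension $1\to A\to G^*\to G\to 1$ such that the corresponding transgression map $\mathrm{tra}:\mathrm{Hom}(A,\mathbb C^\times)\to \mathrm H^2(G,\mathbb C^\times)$ is an isomorphism. Here, for a set-theoretic section $\mu:G\to G^*$, $\mathrm{tra}(f)$ is the class of the 2-cocycle $(g,h)\mapsto f\big(\mu(g)\mu(h)\mu(gh)^{-1}\big)$. *)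

theory Defs
  imports "HOL-Algebra.Algebra" Complex_Main
begin

section \<open>Group presentations\<close>

text \<open>A word is a list of signed letters: \<open>(s, True)\<close> stands for the generator \<open>s\<close> and
  \<open>(s, False)\<close> for its formal inverse.\<close>

type_synonym 's word = "('s \<times> bool) list"

definition words :: "'s set \<Rightarrow> 's word set"
  where "words S = lists (S \<times> UNIV)"

definition letter :: "'s \<Rightarrow> 's word"
  where "letter s = [(s, True)]"

definition word_inv :: "'s word \<Rightarrow> 's word"
  where "word_inv w = rev (map (\<lambda>(s, b). (s, \<not> b)) w)"

definition word_pow :: "'s word \<Rightarrow> int \<Rightarrow> 's word"
  where "word_pow w k =
    concat (replicate (nat \<bar>k\<bar>) (if 0 \<le> k then w else word_inv w))"

definition word_comm :: "'s word \<Rightarrow> 's word \<Rightarrow> 's word"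
  where "word_comm u v = u @ v @ word_inv u @ word_inv v"

text \<open>The congruence on the free monoid on signed letters generated by the cancellation rules
  and by the relations \<open>u = v\<close> with \<open>(u, v) \<in> R\<close>.\<close>

inductive word_eq :: "'s set \<Rightarrow> ('s word \<times> 's word) set \<Rightarrow> 's word \<Rightarrow> 's word \<Rightarrow> bool"
  for S R where
  refl: "w \<in> words S \<Longrightarrow> word_eq S R w w"
| sym: "word_eq S R u v \<Longrightarrow> word_eq S R v u"
| trans: "word_eq S R u v \<Longrightarrow> word_eq S R v w \<Longrightarrow> word_eq S R u w"
| append: "word_eq S R u u' \<Longrightarrow> word_eq S R v v' \<Longrightarrow> word_eq S R (u @ v) (u' @ v')"
| cancel: "s \<in> S \<Longrightarrow> word_eq S R [(s, b), (s, \<not> b)] []"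
| rel: "(u, v) \<in> R \<Longrightarrow> u \<in> words S \<Longrightarrow> v \<in> words S \<Longrightarrow> word_eq S R u v"

definition word_rel :: "'s set \<Rightarrow> ('s word \<times> 's word) set \<Rightarrow> ('s word \<times> 's word) set"
  where "word_rel S R = {(u, v). word_eq S R u v}"

definition presented_group :: "'s set \<Rightarrow> ('s word \<times> 's word) set \<Rightarrow> 's word set monoid"
  where "presented_group S R =
    \<lparr>carrier = words S // word_rel S R,
     monoid.mult = (\<lambda>C D. \<Union>u\<in>C. \<Union>v\<in>D. word_rel S R `` {u @ v}),
     one = word_rel S R `` {[]}\<rparr>"

lemma word_eq_words:
  assumes "word_eq S R u v"
  shows "u \<in> words S" "v \<in> words S"
  using assms by (induction rule: word_eq.induct) (auto simp: words_def)

lemma equiv_word_rel: "equiv (words S) (word_rel S R)"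
proof (rule equivI)
  show "word_rel S R \<subseteq> words S \<times> words S"
    by (auto simp: word_rel_def dest: word_eq_words)
  show "refl_on (words S) (word_rel S R)"
    by (auto simp: word_rel_def refl_on_def intro: word_eq.refl)
  show "sym (word_rel S R)"
    by (auto simp: word_rel_def sym_def intro: word_eq.sym)
  show "trans (word_rel S R)"
    unfolding word_rel_def trans_def by (blast intro: word_eq.trans)
qed

lemma word_class_eq: "word_eq S R u v \<Longrightarrow> word_rel S R `` {u} = word_rel S R `` {v}"
  by (rule equiv_class_eq[OF equiv_word_rel]) (simp add: word_rel_def)

lemma mult_presented_group_class:
  assumes "u \<in> words S" "v \<in> words S"
  shows "word_rel S R `` {u} \<otimes>\<^bsub>presented_group S R\<^esub> word_rel S R `` {v} = word_rel S R `` {u @ v}"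
proof -
  have "word_rel S R `` {u' @ v'} = word_rel S R `` {u @ v}"
    if "u' \<in> word_rel S R `` {u}" "v' \<in> word_rel S R `` {v}" for u' v'
    by (rule word_class_eq, rule word_eq.sym, rule word_eq.append)
      (use that in \<open>simp_all add: word_rel_def\<close>)
  moreover have "u \<in> word_rel S R `` {u}" "v \<in> word_rel S R `` {v}"
    using assms by (simp_all add: word_rel_def word_eq.refl)
  ultimately have "(\<Union>u'\<in>word_rel S R `` {u}. \<Union>v'\<in>word_rel S R `` {v}. word_rel S R `` {u' @ v'})
      = word_rel S R `` {u @ v}"
    by blast
  then show ?thesis by (simp add: presented_group_def)
qed

lemma word_inv_in_words: "w \<in> words S \<Longrightarrow> word_inv w \<in> words S"
  by (auto simp: words_def word_inv_def)

lemma word_eq_inv_left: "w \<in> words S \<Longrightarrow> word_eq S R (word_inv w @ w) []"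
proof (induction w)
  case Nil
  then show ?case by (auto simp: word_inv_def intro: word_eq.refl)
next
  case (Cons a w)
  obtain s b where a: "a = (s, b)" by force
  from Cons.prems have s: "s \<in> S" and w: "w \<in> words S" by (auto simp: words_def a)
  have "word_eq S R [(s, \<not> b), (s, b)] []"
    using word_eq.cancel[OF s, of R "\<not> b"] by simp
  then have "word_eq S R (word_inv w @ [(s, \<not> b), (s, b)] @ w) (word_inv w @ [] @ w)"
    by (intro word_eq.append word_eq.refl w word_inv_in_words)
  then have "word_eq S R (word_inv (a # w) @ a # w) (word_inv w @ w)"
    by (simp add: word_inv_def a)
  then show ?case using Cons.IH[OF w] by (rule word_eq.trans)
qed

lemma group_presented_group: "group (presented_group S R)"
proof (rule groupI)
  have app: "u @ v \<in> words S" if "u \<in> words S" "v \<in> words S" for u v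
    using that by (auto simp: words_def)
  have nil: "[] \<in> words S" by (simp add: words_def)
  have one: "\<one>\<^bsub>presented_group S R\<^esub> = word_rel S R `` {[]}"
    by (simp add: presented_group_def)
  have cl: "word_rel S R `` {u} \<in> carrier (presented_group S R)" if "u \<in> words S" for u
    using that by (auto simp: presented_group_def quotient_def)
  have rep: "\<exists>u\<in>words S. C = word_rel S R `` {u}"
    if "C \<in> carrier (presented_group S R)" for C
    using that by (auto simp: presented_group_def quotient_def)
  note m = mult_presented_group_class
  show "\<one>\<^bsub>presented_group S R\<^esub> \<in> carrier (presented_group S R)"
    unfolding one by (intro cl nil)
  fix C assume "C \<in> carrier (presented_group S R)"
  then obtain u where u: "u \<in> words S" "C = word_rel S R `` {u}" using rep by blast
  show "\<one>\<^bsub>presented_group S R\<^esub> \<otimes>\<^bsub>presented_group S R\<^esub> C = C"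
    unfolding one u using u nil by (simp add: m)
  have "word_rel S R `` {word_inv u} \<otimes>\<^bsub>presented_group S R\<^esub> C = \<one>\<^bsub>presented_group S R\<^esub>"
    unfolding one u using u word_eq_inv_left[OF u(1)]
    by (simp add: m word_inv_in_words word_class_eq)
  then show "\<exists>D\<in>carrier (presented_group S R). D \<otimes>\<^bsub>presented_group S R\<^esub> C = \<one>\<^bsub>presented_group S R\<^esub>"
    using cl[OF word_inv_in_words[OF u(1)]] by blast
  fix D assume "D \<in> carrier (presented_group S R)"
  then obtain v where v: "v \<in> words S" "D = word_rel S R `` {v}" using rep by blast
  show "C \<otimes>\<^bsub>presented_group S R\<^esub> D \<in> carrier (presented_group S R)"
    unfolding u v using u v by (simp add: m cl app)
  fix E assume "E \<in> carrier (presented_group S R)"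
  then obtain w where w: "w \<in> words S" "E = word_rel S R `` {w}" using rep by blast
  show "C \<otimes>\<^bsub>presented_group S R\<^esub> D \<otimes>\<^bsub>presented_group S R\<^esub> E
      = C \<otimes>\<^bsub>presented_group S R\<^esub> (D \<otimes>\<^bsub>presented_group S R\<^esub> E)"
    unfolding u v w using u v w by (simp add: m app)
qed


section \<open>The groups \<open>F\<^sub>n(r,t)\<close>\<close>

datatype gen = GenX nat | GenZ nat nat

definition F_gens :: "nat \<Rightarrow> gen set"
  where "F_gens n = {GenX k | k. 1 \<le> k \<and> k \<le> n + 1} \<union> {GenZ i j | i j. 1 \<le> i \<and> i < j \<and> j \<le> n + 1}"

text \<open>For exponent \<open>0\<close> the power relations read \<open>[] = []\<close>, so they are vacuous.
  The last set of relations makes the generators \<open>GenZ i j\<close> central.\<close>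

definition F_rels :: "nat \<Rightarrow> nat \<Rightarrow> int \<Rightarrow> (gen word \<times> gen word) set"
  where "F_rels n r t =
    {(word_comm (letter (GenX i)) (letter (GenX j)), letter (GenZ i j)) | i j. 1 \<le> i \<and> i < j \<and> j \<le> n + 1}
    \<union> {(word_pow (letter (GenX 1)) t, [])}
    \<union> {(word_pow (letter (GenX j)) (int r), []) | j. 2 \<le> j \<and> j \<le> n + 1}
    \<union> {(word_comm (letter (GenZ i j)) (letter g), []) | i j g.
         1 \<le> i \<and> i < j \<and> j \<le> n + 1 \<and> g \<in> F_gens n}"

definition F_group :: "nat \<Rightarrow> nat \<Rightarrow> int \<Rightarrow> gen word set monoid"
  where "F_group n r t = presented_group (F_gens n) (F_rels n r t)"

lemma F_rels_words: "(u, v) \<in> F_rels n r t \<Longrightarrow> u \<in> words (F_gens n) \<and> v \<in> words (F_gens n)"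
  by (auto simp: F_rels_def words_def word_comm_def word_pow_def word_inv_def letter_def F_gens_def
      split: if_splits)


section \<open>Second cohomology with trivial action\<close>

text \<open>Functions are taken extensional, so that equality of functions means equality on the
  group; this makes \<open>hom_group\<close> and the cohomology groups free of duplicate elements.\<close>

definition hom_group :: "('a, 'c) monoid_scheme \<Rightarrow> ('m, 'd) monoid_scheme \<Rightarrow> ('a \<Rightarrow> 'm) monoid"
  where "hom_group A M =
    (product_group (carrier A) (\<lambda>_. M))\<lparr>carrier := hom A M \<inter> extensional (carrier A)\<rparr>"

definition cocycles2 :: "('g, 'c) monoid_scheme \<Rightarrow> ('m, 'd) monoid_scheme \<Rightarrow> ('g \<times> 'g \<Rightarrow> 'm) set"
  where "cocycles2 G M =
    {f \<in> carrier G \<times> carrier G \<rightarrow>\<^sub>E carrier M.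
      \<forall>g\<in>carrier G. \<forall>h\<in>carrier G. \<forall>k\<in>carrier G.
        f (g, h) \<otimes>\<^bsub>M\<^esub> f (g \<otimes>\<^bsub>G\<^esub> h, k) = f (h, k) \<otimes>\<^bsub>M\<^esub> f (g, h \<otimes>\<^bsub>G\<^esub> k)}"

definition coboundary2 ::
    "('g, 'c) monoid_scheme \<Rightarrow> ('m, 'd) monoid_scheme \<Rightarrow> ('g \<Rightarrow> 'm) \<Rightarrow> 'g \<times> 'g \<Rightarrow> 'm"
  where "coboundary2 G M c =
    (\<lambda>(g, h)\<in>carrier G \<times> carrier G. c g \<otimes>\<^bsub>M\<^esub> c h \<otimes>\<^bsub>M\<^esub> inv\<^bsub>M\<^esub> c (g \<otimes>\<^bsub>G\<^esub> h))"

definition coboundaries2 :: "('g, 'c) monoid_scheme \<Rightarrow> ('m, 'd) monoid_scheme \<Rightarrow> ('g \<times> 'g \<Rightarrow> 'm) set"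
  where "coboundaries2 G M = coboundary2 G M ` (carrier G \<rightarrow> carrier M)"

definition cocycle_group2 ::
    "('g, 'c) monoid_scheme \<Rightarrow> ('m, 'd) monoid_scheme \<Rightarrow> ('g \<times> 'g \<Rightarrow> 'm) monoid"
  where "cocycle_group2 G M =
    (product_group (carrier G \<times> carrier G) (\<lambda>_. M))\<lparr>carrier := cocycles2 G M\<rparr>"

definition H2 :: "('g, 'c) monoid_scheme \<Rightarrow> ('m, 'd) monoid_scheme \<Rightarrow> ('g \<times> 'g \<Rightarrow> 'm) set monoid"
  where "H2 G M = cocycle_group2 G M Mod coboundaries2 G M"

lemma comm_group_product_group:
  assumes "comm_group M"
  shows "comm_group (product_group I (\<lambda>_. M))"
proof -
  interpret M: comm_group M by fact
  show ?thesis
    by (rule group.group_comm_groupI)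
      (auto simp: M.is_group M.m_comm PiE_iff intro!: restrict_ext)
qed

lemma comm_group_cocycle_group2:
  assumes "group G" "comm_group M"
  shows "comm_group (cocycle_group2 G M)"
proof -
  interpret G: group G by fact
  interpret M: comm_group M by fact
  let ?P = "product_group (carrier G \<times> carrier G) (\<lambda>_. M)"
  interpret P: comm_group ?P by (intro comm_group_product_group assms)
  have "subgroup (cocycles2 G M) ?P"
  proof (rule P.subgroupI)
    show "cocycles2 G M \<subseteq> carrier ?P"
      by (auto simp: cocycles2_def)
    have "(\<lambda>x\<in>carrier G \<times> carrier G. \<one>\<^bsub>M\<^esub>) \<in> cocycles2 G M"
      by (auto simp: cocycles2_def)
    then show "cocycles2 G M \<noteq> {}" by blast
  next
    fix f assume f: "f \<in> cocycles2 G M"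
    then have inv: "inv\<^bsub>?P\<^esub> f = (\<lambda>x\<in>carrier G \<times> carrier G. inv\<^bsub>M\<^esub> f x)"
      by (intro inv_product_group) (auto simp: cocycles2_def M.is_group)
    have mem: "f (g, h) \<in> carrier M" if "g \<in> carrier G" "h \<in> carrier G" for g h
      using f that by (auto simp: cocycles2_def PiE_iff)
    show "inv\<^bsub>?P\<^esub> f \<in> cocycles2 G M"
      unfolding inv using f mem by (auto simp: cocycles2_def M.inv_mult[symmetric])
  next
    fix f f' assume f: "f \<in> cocycles2 G M" and f': "f' \<in> cocycles2 G M"
    have mem: "f (g, h) \<in> carrier M" "f' (g, h) \<in> carrier M"
      if "g \<in> carrier G" "h \<in> carrier G" for g h
      using f f' that by (auto simp: cocycles2_def PiE_iff)
    have shuffle: "(a \<otimes>\<^bsub>M\<^esub> a') \<otimes>\<^bsub>M\<^esub> (b \<otimes>\<^bsub>M\<^esub> b') = (a \<otimes>\<^bsub>M\<^esub> b) \<otimes>\<^bsub>M\<^esub> (a' \<otimes>\<^bsub>M\<^esub> b')"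
      if "a \<in> carrier M" "a' \<in> carrier M" "b \<in> carrier M" "b' \<in> carrier M" for a a' b b'
      using that by (simp add: M.m_ac)
    show "f \<otimes>\<^bsub>?P\<^esub> f' \<in> cocycles2 G M"
      unfolding cocycles2_def
    proof (intro CollectI conjI ballI)
      show "f \<otimes>\<^bsub>?P\<^esub> f' \<in> carrier G \<times> carrier G \<rightarrow>\<^sub>E carrier M"
        using mem by auto
      fix g h k assume "g \<in> carrier G" "h \<in> carrier G" "k \<in> carrier G"
      moreover from this
      have "f (g, h) \<otimes>\<^bsub>M\<^esub> f (g \<otimes>\<^bsub>G\<^esub> h, k) = f (h, k) \<otimes>\<^bsub>M\<^esub> f (g, h \<otimes>\<^bsub>G\<^esub> k)"
        "f' (g, h) \<otimes>\<^bsub>M\<^esub> f' (g \<otimes>\<^bsub>G\<^esub> h, k) = f' (h, k) \<otimes>\<^bsub>M\<^esub> f' (g, h \<otimes>\<^bsub>G\<^esub> k)"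
        using f f' by (simp_all add: cocycles2_def)
      ultimately show "(f \<otimes>\<^bsub>?P\<^esub> f') (g, h) \<otimes>\<^bsub>M\<^esub> (f \<otimes>\<^bsub>?P\<^esub> f') (g \<otimes>\<^bsub>G\<^esub> h, k)
          = (f \<otimes>\<^bsub>?P\<^esub> f') (h, k) \<otimes>\<^bsub>M\<^esub> (f \<otimes>\<^bsub>?P\<^esub> f') (g, h \<otimes>\<^bsub>G\<^esub> k)"
        by (simp add: shuffle[of "f (g, h)" "f' (g, h)" "f (g \<otimes>\<^bsub>G\<^esub> h, k)" "f' (g \<otimes>\<^bsub>G\<^esub> h, k)"]
            shuffle[of "f (h, k)" "f' (h, k)" "f (g, h \<otimes>\<^bsub>G\<^esub> k)" "f' (g, h \<otimes>\<^bsub>G\<^esub> k)"] mem)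
    qed
  qed
  then interpret Z: subgroup "cocycles2 G M" ?P .
  show ?thesis
    unfolding cocycle_group2_def
    by (intro group.group_comm_groupI Z.subgroup_is_group P.is_group)
      (simp_all add: P.m_comm Z.mem_carrier del: mult_product_group carrier_product_group)
qed

lemma subgroup_coboundaries2:
  assumes "group G" "comm_group M"
  shows "subgroup (coboundaries2 G M) (cocycle_group2 G M)"
proof -
  interpret G: group G by fact
  interpret M: comm_group M by fact
  interpret C: comm_group "cocycle_group2 G M" by (intro comm_group_cocycle_group2 assms)
  have memM: "c g \<in> carrier M" if "c \<in> carrier G \<rightarrow> carrier M" "g \<in> carrier G" for c g
    using that by blast
  have sub: "coboundary2 G M c \<in> cocycles2 G M" if c: "c \<in> carrier G \<rightarrow> carrier M" for c
  proof -
    have "(c g \<otimes>\<^bsub>M\<^esub> c h \<otimes>\<^bsub>M\<^esub> inv\<^bsub>M\<^esub> c (g \<otimes>\<^bsub>G\<^esub> h))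
        \<otimes>\<^bsub>M\<^esub> (c (g \<otimes>\<^bsub>G\<^esub> h) \<otimes>\<^bsub>M\<^esub> c k \<otimes>\<^bsub>M\<^esub> inv\<^bsub>M\<^esub> c (g \<otimes>\<^bsub>G\<^esub> h \<otimes>\<^bsub>G\<^esub> k))
      = (c h \<otimes>\<^bsub>M\<^esub> c k \<otimes>\<^bsub>M\<^esub> inv\<^bsub>M\<^esub> c (h \<otimes>\<^bsub>G\<^esub> k))
        \<otimes>\<^bsub>M\<^esub> (c g \<otimes>\<^bsub>M\<^esub> c (h \<otimes>\<^bsub>G\<^esub> k) \<otimes>\<^bsub>M\<^esub> inv\<^bsub>M\<^esub> c (g \<otimes>\<^bsub>G\<^esub> (h \<otimes>\<^bsub>G\<^esub> k)))"
      if "g \<in> carrier G" "h \<in> carrier G" "k \<in> carrier G" for g h k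
    proof -
      have aux: "(x \<otimes>\<^bsub>M\<^esub> y \<otimes>\<^bsub>M\<^esub> inv\<^bsub>M\<^esub> p) \<otimes>\<^bsub>M\<^esub> (p \<otimes>\<^bsub>M\<^esub> z \<otimes>\<^bsub>M\<^esub> q) = x \<otimes>\<^bsub>M\<^esub> (y \<otimes>\<^bsub>M\<^esub> (z \<otimes>\<^bsub>M\<^esub> q))"
        if "x \<in> carrier M" "y \<in> carrier M" "z \<in> carrier M" "p \<in> carrier M" "q \<in> carrier M"
        for x y z p q
        using that by (simp add: M.m_assoc M.inv_solve_left' flip: M.m_assoc[of "inv\<^bsub>M\<^esub> p" p])
      have aux': "(y \<otimes>\<^bsub>M\<^esub> z \<otimes>\<^bsub>M\<^esub> inv\<^bsub>M\<^esub> p) \<otimes>\<^bsub>M\<^esub> (x \<otimes>\<^bsub>M\<^esub> p \<otimes>\<^bsub>M\<^esub> q) = x \<otimes>\<^bsub>M\<^esub> (y \<otimes>\<^bsub>M\<^esub> (z \<otimes>\<^bsub>M\<^esub> q))"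
        if "x \<in> carrier M" "y \<in> carrier M" "z \<in> carrier M" "p \<in> carrier M" "q \<in> carrier M"
        for x y z p q
      proof -
        have "(y \<otimes>\<^bsub>M\<^esub> z \<otimes>\<^bsub>M\<^esub> inv\<^bsub>M\<^esub> p) \<otimes>\<^bsub>M\<^esub> (x \<otimes>\<^bsub>M\<^esub> p \<otimes>\<^bsub>M\<^esub> q)
            = (y \<otimes>\<^bsub>M\<^esub> z \<otimes>\<^bsub>M\<^esub> inv\<^bsub>M\<^esub> p) \<otimes>\<^bsub>M\<^esub> (p \<otimes>\<^bsub>M\<^esub> x \<otimes>\<^bsub>M\<^esub> q)"
          using that by (simp add: M.m_comm)
        also have "\<dots> = y \<otimes>\<^bsub>M\<^esub> (z \<otimes>\<^bsub>M\<^esub> (x \<otimes>\<^bsub>M\<^esub> q))" using that by (intro aux)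
        finally show ?thesis using that by (simp add: M.m_ac)
      qed
      show ?thesis using that by (simp add: aux aux' memM[OF c] G.m_assoc)
    qed
    then show ?thesis using memM[OF c] by (auto simp: coboundary2_def cocycles2_def)
  qed
  have mult: "coboundary2 G M c \<otimes>\<^bsub>cocycle_group2 G M\<^esub> coboundary2 G M d
      = coboundary2 G M (\<lambda>g. c g \<otimes>\<^bsub>M\<^esub> d g)"
    if "c \<in> carrier G \<rightarrow> carrier M" "d \<in> carrier G \<rightarrow> carrier M" for c d
    using memM[OF that(1)] memM[OF that(2)]
    by (auto simp: coboundary2_def cocycle_group2_def M.inv_mult M.m_ac intro!: restrict_ext)
  have one: "coboundary2 G M (\<lambda>_. \<one>\<^bsub>M\<^esub>) = \<one>\<^bsub>cocycle_group2 G M\<^esub>"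
    by (auto simp: coboundary2_def cocycle_group2_def intro!: restrict_ext)
  have carr: "carrier (cocycle_group2 G M) = cocycles2 G M"
    by (simp add: cocycle_group2_def)
  show ?thesis
  proof (rule C.subgroupI)
    show "coboundaries2 G M \<subseteq> carrier (cocycle_group2 G M)"
      using sub by (auto simp: coboundaries2_def carr)
    show "coboundaries2 G M \<noteq> {}"
      by (auto simp: coboundaries2_def intro!: exI[of _ "\<lambda>_. \<one>\<^bsub>M\<^esub>"])
  next
    fix a assume "a \<in> coboundaries2 G M"
    then obtain c where c: "c \<in> carrier G \<rightarrow> carrier M" "a = coboundary2 G M c"
      by (auto simp: coboundaries2_def)
    let ?d = "\<lambda>g. inv\<^bsub>M\<^esub> c g"
    have d: "?d \<in> carrier G \<rightarrow> carrier M" using c by auto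
    have "coboundary2 G M ?d \<otimes>\<^bsub>cocycle_group2 G M\<^esub> a = coboundary2 G M (\<lambda>g. ?d g \<otimes>\<^bsub>M\<^esub> c g)"
      using mult[OF d c(1)] c by simp
    also have "\<dots> = coboundary2 G M (\<lambda>_. \<one>\<^bsub>M\<^esub>)"
      using memM[OF c(1)] by (auto simp: coboundary2_def intro!: restrict_ext)
    finally have "inv\<^bsub>cocycle_group2 G M\<^esub> a = coboundary2 G M ?d"
      unfolding one using sub[OF d] sub[OF c(1)] c(2) by (intro C.inv_equality) (auto simp: carr)
    then show "inv\<^bsub>cocycle_group2 G M\<^esub> a \<in> coboundaries2 G M"
      using d by (auto simp: coboundaries2_def)
  next
    fix a b assume "a \<in> coboundaries2 G M" "b \<in> coboundaries2 G M"
    then obtain c d where "c \<in> carrier G \<rightarrow> carrier M" "a = coboundary2 G M c"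
        "d \<in> carrier G \<rightarrow> carrier M" "b = coboundary2 G M d"
      by (auto simp: coboundaries2_def)
    moreover from this have "(\<lambda>g. c g \<otimes>\<^bsub>M\<^esub> d g) \<in> carrier G \<rightarrow> carrier M" by auto
    ultimately show "a \<otimes>\<^bsub>cocycle_group2 G M\<^esub> b \<in> coboundaries2 G M"
      by (auto simp: coboundaries2_def mult)
  qed
qed

lemma comm_group_H2:
  assumes "group G" "comm_group M"
  shows "comm_group (H2 G M)"
  unfolding H2_def
  by (intro comm_group.abelian_FactGroup comm_group_cocycle_group2 subgroup_coboundaries2 assms)


section \<open>Central extensions, transgression and representation groups\<close>

definition central_extension ::
    "('a, 'c) monoid_scheme \<Rightarrow> ('a \<Rightarrow> 'e) \<Rightarrow> ('e, 'd) monoid_scheme \<Rightarrow> ('e \<Rightarrow> 'g)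
      \<Rightarrow> ('g, 'f) monoid_scheme \<Rightarrow> bool"
  where "central_extension A \<iota> E \<pi> G \<longleftrightarrow>
    group A \<and> group E \<and> group G \<and> \<iota> \<in> mon A E \<and> \<pi> \<in> epi E G \<and>
    kernel E G \<pi> = \<iota> ` carrier A \<and>
    (\<forall>a\<in>carrier A. \<forall>x\<in>carrier E. \<iota> a \<otimes>\<^bsub>E\<^esub> x = x \<otimes>\<^bsub>E\<^esub> \<iota> a)"

definition is_section ::
    "('e, 'd) monoid_scheme \<Rightarrow> ('e \<Rightarrow> 'g) \<Rightarrow> ('g, 'f) monoid_scheme \<Rightarrow> ('g \<Rightarrow> 'e) \<Rightarrow> bool"
  where "is_section E \<pi> G \<mu> \<longleftrightarrow> \<mu> \<in> carrier G \<rightarrow> carrier E \<and> (\<forall>g\<in>carrier G. \<pi> (\<mu> g) = g)"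

text \<open>The element \<open>\<mu>(g) \<mu>(h) \<mu>(gh)\<inverse>\<close> lies in the image of \<open>\<iota>\<close>; it is pulled back
  to \<open>A\<close> before \<open>f\<close> is applied.\<close>

definition transgression_cocycle ::
    "('a, 'c) monoid_scheme \<Rightarrow> ('a \<Rightarrow> 'e) \<Rightarrow> ('e, 'd) monoid_scheme
      \<Rightarrow> ('g, 'f) monoid_scheme \<Rightarrow> ('g \<Rightarrow> 'e) \<Rightarrow> ('a \<Rightarrow> 'm) \<Rightarrow> 'g \<times> 'g \<Rightarrow> 'm"
  where "transgression_cocycle A \<iota> E G \<mu> f =
    (\<lambda>(g, h)\<in>carrier G \<times> carrier G.
       f (inv_into (carrier A) \<iota> (\<mu> g \<otimes>\<^bsub>E\<^esub> \<mu> h \<otimes>\<^bsub>E\<^esub> inv\<^bsub>E\<^esub> \<mu> (g \<otimes>\<^bsub>G\<^esub> h))))"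

definition transgression ::
    "('a, 'c) monoid_scheme \<Rightarrow> ('a \<Rightarrow> 'e) \<Rightarrow> ('e, 'd) monoid_scheme
      \<Rightarrow> ('g, 'f) monoid_scheme \<Rightarrow> ('m, 'k) monoid_scheme \<Rightarrow> ('g \<Rightarrow> 'e) \<Rightarrow> ('a \<Rightarrow> 'm)
      \<Rightarrow> ('g \<times> 'g \<Rightarrow> 'm) set"
  where "transgression A \<iota> E G M \<mu> f =
    coboundaries2 G M #>\<^bsub>cocycle_group2 G M\<^esub> transgression_cocycle A \<iota> E G \<mu> f"

lemma section_exists:
  assumes "central_extension A \<iota> E \<pi> G"
  shows "is_section E \<pi> G (inv_into (carrier E) \<pi>)"
  using assms
  by (auto simp: central_extension_def is_section_def epi_def inv_into_into f_inv_into_f)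

lemma transgression_cocycle_change_section:
  assumes ext: "central_extension A \<iota> E \<pi> G" and M: "comm_group M"
    and f: "f \<in> hom A M" and \<mu>: "is_section E \<pi> G \<mu>" and \<mu>': "is_section E \<pi> G \<mu>'"
  obtains c where "c \<in> carrier G \<rightarrow> carrier M"
    "transgression_cocycle A \<iota> E G \<mu>' f
      = coboundary2 G M c \<otimes>\<^bsub>cocycle_group2 G M\<^esub> transgression_cocycle A \<iota> E G \<mu> f"
proof -
  interpret A: group A using ext by (simp add: central_extension_def)
  interpret E: group E using ext by (simp add: central_extension_def)
  interpret G: group G using ext by (simp add: central_extension_def)
  interpret M: comm_group M by fact
  interpret \<pi>: group_hom E G \<pi>
    using ext by unfold_locales (auto simp: central_extension_def epi_def)
  interpret \<iota>: group_hom A E \<iota>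
    using ext by unfold_locales (auto simp: central_extension_def mon_def)
  interpret f: group_hom A M f
    using f by unfold_locales
  define K where "K = kernel E G \<pi>"
  have K: "K = \<iota> ` carrier A" and inj: "inj_on \<iota> (carrier A)"
    and cen: "\<And>k x. k \<in> K \<Longrightarrow> x \<in> carrier E \<Longrightarrow> k \<otimes>\<^bsub>E\<^esub> x = x \<otimes>\<^bsub>E\<^esub> k"
    using ext by (auto simp: central_extension_def K_def mon_def)
  interpret K: subgroup K E unfolding K_def by (rule \<pi>.subgroup_kernel)
  define \<beta> where "\<beta> = inv_into (carrier A) \<iota>"
  have \<beta>[simp]: "\<beta> k \<in> carrier A" "\<iota> (\<beta> k) = k" if "k \<in> K" for k
    using that unfolding \<beta>_def K by (auto simp: inv_into_into f_inv_into_f)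
  have \<beta>_mult: "\<beta> (k \<otimes>\<^bsub>E\<^esub> l) = \<beta> k \<otimes>\<^bsub>A\<^esub> \<beta> l" if "k \<in> K" "l \<in> K" for k l
    by (rule inj_onD[OF inj]) (use that in simp_all)
  have \<beta>_inv: "\<beta> (inv\<^bsub>E\<^esub> k) = inv\<^bsub>A\<^esub> \<beta> k" if "k \<in> K" for k
    by (rule inj_onD[OF inj]) (use that in simp_all)
  have mu[simp]: "\<mu> g \<in> carrier E" "\<mu>' g \<in> carrier E" "\<pi> (\<mu> g) = g" "\<pi> (\<mu>' g) = g"
    if "g \<in> carrier G" for g
    using \<mu> \<mu>' that by (auto simp: is_section_def)
  define u where "u g = \<mu>' g \<otimes>\<^bsub>E\<^esub> inv\<^bsub>E\<^esub> \<mu> g" for g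
  define d where "d g h = \<mu> g \<otimes>\<^bsub>E\<^esub> \<mu> h \<otimes>\<^bsub>E\<^esub> inv\<^bsub>E\<^esub> \<mu> (g \<otimes>\<^bsub>G\<^esub> h)" for g h
  have uK[simp]: "u g \<in> K" if "g \<in> carrier G" for g
    using that unfolding u_def K_def kernel_def by simp
  have dK[simp]: "d g h \<in> K" if "g \<in> carrier G" "h \<in> carrier G" for g h
    using that unfolding d_def K_def kernel_def by simp
  have \<mu>'_eq: "\<mu>' g = u g \<otimes>\<^bsub>E\<^esub> \<mu> g" if "g \<in> carrier G" for g
    using that by (simp add: u_def E.m_assoc)
  have eq: "\<mu>' g \<otimes>\<^bsub>E\<^esub> \<mu>' h \<otimes>\<^bsub>E\<^esub> inv\<^bsub>E\<^esub> \<mu>' (g \<otimes>\<^bsub>G\<^esub> h)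
      = u g \<otimes>\<^bsub>E\<^esub> u h \<otimes>\<^bsub>E\<^esub> inv\<^bsub>E\<^esub> u (g \<otimes>\<^bsub>G\<^esub> h) \<otimes>\<^bsub>E\<^esub> d g h"
    if g: "g \<in> carrier G" and h: "h \<in> carrier G" for g h
  proof -
    let ?w = "inv\<^bsub>E\<^esub> u (g \<otimes>\<^bsub>G\<^esub> h)"
    have mem[simp]: "u g \<in> carrier E" "u h \<in> carrier E" "u (g \<otimes>\<^bsub>G\<^esub> h) \<in> carrier E"
      "d g h \<in> carrier E"
      using g h by simp_all
    have "\<mu>' g \<otimes>\<^bsub>E\<^esub> \<mu>' h = u g \<otimes>\<^bsub>E\<^esub> ((\<mu> g \<otimes>\<^bsub>E\<^esub> u h) \<otimes>\<^bsub>E\<^esub> \<mu> h)"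
      using g h by (simp add: \<mu>'_eq E.m_assoc)
    also have "\<mu> g \<otimes>\<^bsub>E\<^esub> u h = u h \<otimes>\<^bsub>E\<^esub> \<mu> g"
      using g h by (simp add: cen)
    finally have 1: "\<mu>' g \<otimes>\<^bsub>E\<^esub> \<mu>' h = u g \<otimes>\<^bsub>E\<^esub> (u h \<otimes>\<^bsub>E\<^esub> \<mu> g \<otimes>\<^bsub>E\<^esub> \<mu> h)" .
    have 2: "inv\<^bsub>E\<^esub> \<mu>' (g \<otimes>\<^bsub>G\<^esub> h) = inv\<^bsub>E\<^esub> \<mu> (g \<otimes>\<^bsub>G\<^esub> h) \<otimes>\<^bsub>E\<^esub> ?w"
      using g h by (simp add: \<mu>'_eq E.inv_mult_group)
    have "\<mu>' g \<otimes>\<^bsub>E\<^esub> \<mu>' h \<otimes>\<^bsub>E\<^esub> inv\<^bsub>E\<^esub> \<mu>' (g \<otimes>\<^bsub>G\<^esub> h)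
        = u g \<otimes>\<^bsub>E\<^esub> u h \<otimes>\<^bsub>E\<^esub> (d g h \<otimes>\<^bsub>E\<^esub> ?w)"
      using g h unfolding 1 2 d_def by (simp add: E.m_assoc)
    also have "d g h \<otimes>\<^bsub>E\<^esub> ?w = ?w \<otimes>\<^bsub>E\<^esub> d g h"
      using g h by (intro cen) simp_all
    finally show ?thesis using g h by (simp add: E.m_assoc)
  qed
  have val: "f (\<beta> (\<mu>' g \<otimes>\<^bsub>E\<^esub> \<mu>' h \<otimes>\<^bsub>E\<^esub> inv\<^bsub>E\<^esub> \<mu>' (g \<otimes>\<^bsub>G\<^esub> h)))
      = f (\<beta> (u g)) \<otimes>\<^bsub>M\<^esub> f (\<beta> (u h)) \<otimes>\<^bsub>M\<^esub> inv\<^bsub>M\<^esub> f (\<beta> (u (g \<otimes>\<^bsub>G\<^esub> h))) \<otimes>\<^bsub>M\<^esub> f (\<beta> (d g h))"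
    if "g \<in> carrier G" "h \<in> carrier G" for g h
  proof -
    have uK': "u g \<in> K" "u h \<in> K" "u (g \<otimes>\<^bsub>G\<^esub> h) \<in> K" "d g h \<in> K"
      using that by simp_all
    then show ?thesis
      unfolding eq[OF that] by (simp add: \<beta>_mult \<beta>_inv)
  qed
  show ?thesis
  proof
    show "(\<lambda>g. f (\<beta> (u g))) \<in> carrier G \<rightarrow> carrier M" by simp
    show "transgression_cocycle A \<iota> E G \<mu>' f = coboundary2 G M (\<lambda>g. f (\<beta> (u g)))
        \<otimes>\<^bsub>cocycle_group2 G M\<^esub> transgression_cocycle A \<iota> E G \<mu> f"
      unfolding transgression_cocycle_def coboundary2_def cocycle_group2_def
      by (auto simp: val d_def simp flip: \<beta>_def intro!: restrict_ext)
  qed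
qed

definition complex_units :: "complex monoid"
  where "complex_units = \<lparr>carrier = UNIV - {0}, monoid.mult = (*), one = 1\<rparr>"

lemma comm_group_complex_units: "comm_group complex_units"
  by (rule comm_groupI) (auto simp: complex_units_def intro!: bexI[of _ "inverse _"])

text \<open>The transgression map does not depend on the section
  (\<open>transgression_cocycle_change_section\<close>), and sections exist
  (\<open>section_exists\<close>); hence the quantification over all sections.  The kernel \<open>A\<close> of the extension may be
  taken on the element type of \<open>E\<close> without loss of generality, since \<open>\<iota>\<close> is injective.\<close>

definition representation_group ::
    "('e, 'd) monoid_scheme \<Rightarrow> ('g, 'f) monoid_scheme \<Rightarrow> bool"
  where "representation_group E G \<longleftrightarrow>
    (\<exists>(A :: 'e monoid) \<iota> \<pi>. central_extension A \<iota> E \<pi> G \<and>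
      (\<forall>\<mu>. is_section E \<pi> G \<mu> \<longrightarrow>
        transgression A \<iota> E G complex_units \<mu> \<in> iso (hom_group A complex_units) (H2 G complex_units)))"

end

theory Submission
  imports Defs
begin

text \<open>Let \<open>Z\<close> be the subgroup of \<open>F\<close> generated by the \<open>z\<^sub>i\<^sub>j\<close>. It is central, \<open>F/Z\<close> is abelian, and \<open>Z\<close> is
  the kernel of \<open>F \<rightarrow> G\<close>. The transgression is injective because \<open>Z\<close> consists of products of
  commutators: if \<open>tra(f)\<close> is trivial, then \<open>f\<close> extends to a homomorphism \<open>F \<rightarrow> \<complex>\<^sup>\<times>\<close>, which kills
  commutators. It is surjective because every central extension of \<open>G\<close> by \<open>\<complex>\<^sup>\<times>\<close> receives a homomorphism
  from \<open>F\<close> over \<open>G\<close>: \<open>\<complex>\<^sup>\<times>\<close> is divisible, so the generators of \<open>G\<close> lift to elements of the same order,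
  and the commutators of such lifts are central; restricting to \<open>Z\<close> gives the required \<open>f\<close>.\<close>

section \<open>Homomorphisms out of a presented group\<close>

text \<open>The homomorphism from the free group induced by an assignment \<open>h\<close> of the
  letters, computed on words before any relation is imposed.\<close>

primrec word_val :: "('g, 'c) monoid_scheme \<Rightarrow> ('s \<Rightarrow> 'g) \<Rightarrow> 's word \<Rightarrow> 'g"
  where
    "word_val H h [] = \<one>\<^bsub>H\<^esub>"
  | "word_val H h (a # w) = (if snd a then h (fst a) else inv\<^bsub>H\<^esub> h (fst a)) \<otimes>\<^bsub>H\<^esub> word_val H h w"

lemma append_in_words: "u \<in> words S \<Longrightarrow> v \<in> words S \<Longrightarrow> u @ v \<in> words S"
  by (auto simp: words_def)

lemma letter_in_words [simp]: "letter s \<in> words S \<longleftrightarrow> s \<in> S"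
  by (simp add: letter_def words_def)

lemma words_induct [consumes 1, case_names Nil Cons]:
  assumes "w \<in> words S" and "P []"
    and "\<And>s b w. s \<in> S \<Longrightarrow> w \<in> words S \<Longrightarrow> P w \<Longrightarrow> P ((s, b) # w)"
  shows "P w"
  using assms(1) by (induction w) (auto simp: words_def assms(2) intro!: assms(3))

lemma word_val_cong:
  assumes "w \<in> words S" and "\<And>s. s \<in> S \<Longrightarrow> h s = h' s"
  shows "word_val H h w = word_val H h' w"
  using assms by (induction w rule: words_induct) auto

context group
begin

context
  fixes h :: "'s \<Rightarrow> 'a" and S :: "'s set"
  assumes h: "h \<in> S \<rightarrow> carrier G"
begin

lemma word_val_closed [simp]: "w \<in> words S \<Longrightarrow> word_val G h w \<in> carrier G"
  by (induction rule: words_induct) (use h in auto)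

lemma word_val_letter: "s \<in> S \<Longrightarrow> word_val G h (letter s) = h s"
  using h by (auto simp: letter_def Pi_iff)

lemma word_val_append:
  "u \<in> words S \<Longrightarrow> v \<in> words S \<Longrightarrow> word_val G h (u @ v) = word_val G h u \<otimes> word_val G h v"
  by (induction rule: words_induct) (use h in \<open>auto simp: m_assoc Pi_iff\<close>)

lemma word_val_inv: "w \<in> words S \<Longrightarrow> word_val G h (word_inv w) = inv (word_val G h w)"
proof (induction rule: words_induct)
  case (Cons s b w)
  have "word_inv ((s, b) # w) = word_inv w @ [(s, \<not> b)]"
    by (simp add: word_inv_def)
  moreover have "[(s, \<not> b)] \<in> words S"
    using Cons by (simp add: words_def)
  ultimately show ?case
    using Cons h by (auto simp: word_val_append word_inv_in_words inv_mult_group Pi_iff)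
qed (simp add: word_inv_def)

lemma word_val_comm:
  "u \<in> words S \<Longrightarrow> v \<in> words S \<Longrightarrow> word_val G h (word_comm u v)
    = word_val G h u \<otimes> word_val G h v \<otimes> inv (word_val G h u) \<otimes> inv (word_val G h v)"
  by (simp add: word_comm_def word_val_append word_val_inv word_inv_in_words append_in_words m_assoc)

lemma word_val_pow: "w \<in> words S \<Longrightarrow> word_val G h (word_pow w k) = word_val G h w [^] k"
proof -
  \<comment> \<open>Membership and value go through one induction, because
    \<open>word_val_append\<close> asks for membership of both factors.\<close>
  have aux: "concat (replicate m u) \<in> words S
      \<and> word_val G h (concat (replicate m u)) = word_val G h u [^] m"
    if "u \<in> words S" for u and m :: nat
  proof (induction m)
    case 0
    then show ?case by (simp add: words_def)
  next
    case (Suc m)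
    then show ?case
      using that
      by (simp only: replicate_Suc concat.simps append_in_words word_val_append nat_pow_Suc2 word_val_closed)
  qed
  assume w: "w \<in> words S"
  show ?thesis
  proof (cases k)
    case (nonneg m)
    then show ?thesis
      using aux[OF w, of m] by (simp add: word_pow_def int_pow_int)
  next
    \<comment> \<open>Here \<open>k\<close> is \<open>- int (Suc m)\<close>, so the word consists of
      \<open>Suc m\<close> copies of \<open>word_inv w\<close>.\<close>
    case (neg m)
    then show ?thesis
      using aux[OF word_inv_in_words[OF w], of "Suc m"] w int_pow_neg_int[of "word_val G h w" "Suc m"]
        arg_cong[OF nat_pow_Suc2[of "word_val G h w" m], of "m_inv G"]
      by (simp add: word_pow_def word_val_inv nat_pow_inv inv_mult_group del: of_nat_Suc replicate_Suc)
  qed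
qed

text \<open>Induction over the rules generating the congruence: all of them except
  \<open>rel\<close> hold in every group, so only the pairs in \<open>R\<close> have to be
  checked.\<close>

lemma word_val_word_eq:
  assumes "\<And>u v. (u, v) \<in> R \<Longrightarrow> word_val G h u = word_val G h v"
    and "word_eq S R u v"
  shows "word_val G h u = word_val G h v"
  using assms(2)
proof (induction rule: word_eq.induct)
  case (append u u' v v')
  then show ?case using word_eq_words[of S R] by (metis word_val_append)
next
  case (cancel s b)
  then show ?case using h by (auto simp: Pi_iff)
qed (use assms(1) in auto)

end

end

section \<open>The universal property of a presented group\<close>

definition gen_class :: "'s set \<Rightarrow> ('s word \<times> 's word) set \<Rightarrow> 's \<Rightarrow> 's word set"
  where "gen_class S R s = word_rel S R `` {letter s}"

lemma carrier_presented_group: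
  "carrier (presented_group S R) = (\<lambda>w. word_rel S R `` {w}) ` words S"
  by (auto simp: presented_group_def quotient_def)

lemma gen_class_closed [simp]: "s \<in> S \<Longrightarrow> gen_class S R s \<in> carrier (presented_group S R)"
  by (simp add: gen_class_def carrier_presented_group)

text \<open>Evaluation at the classes of the generators is the quotient map on words. Hence these
  classes generate, and each pair in \<open>R\<close> becomes an identity between their
  products.\<close>

lemma word_val_gen_class:
  assumes "w \<in> words S"
  shows "word_val (presented_group S R) (gen_class S R) w = word_rel S R `` {w}"
  using assms
proof (induction rule: words_induct)
  case Nil
  then show ?case by (simp add: presented_group_def)
next
  case (Cons s b w)
  interpret P: group "presented_group S R" by (rule group_presented_group)
  have *: "word_rel S R `` {[(s, c)]} \<otimes>\<^bsub>presented_group S R\<^esub> word_rel S R `` {w'}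
      = word_rel S R `` {(s, c) # w'}" if "w' \<in> words S" for c w'
    using mult_presented_group_class[of "[(s, c)]" S w' R] Cons.hyps that by (simp add: words_def)
  have "word_rel S R `` {[(s, False)]} \<otimes>\<^bsub>presented_group S R\<^esub> gen_class S R s = \<one>\<^bsub>presented_group S R\<^esub>"
    using *[of "letter s" False] word_class_eq[OF word_eq.cancel[OF Cons.hyps(1), of R False]] Cons.hyps
    by (simp add: gen_class_def letter_def[symmetric]) (simp add: letter_def presented_group_def)
  then have "inv\<^bsub>presented_group S R\<^esub> gen_class S R s = word_rel S R `` {[(s, False)]}"
    using Cons.hyps by (intro P.inv_equality gen_class_closed) (simp_all add: carrier_presented_group words_def)
  then show ?case
    using Cons * by (simp add: gen_class_def letter_def)
qed

lemma presented_group_rel: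
  assumes "(u, v) \<in> R" "u \<in> words S" "v \<in> words S"
  shows "word_val (presented_group S R) (gen_class S R) u
    = word_val (presented_group S R) (gen_class S R) v"
  using assms by (simp add: word_val_gen_class word_class_eq word_eq.rel)

text \<open>Von Dyck's theorem. A class is sent to the value of a chosen representative; by
  \<open>word_val_word_eq\<close> the choice does not matter.\<close>

lemma presented_group_hom_exists:
  assumes "group H" and h: "h \<in> S \<rightarrow> carrier H"
    and rel: "\<And>u v. (u, v) \<in> R \<Longrightarrow> word_val H h u = word_val H h v"
  obtains \<phi> where "\<phi> \<in> hom (presented_group S R) H" "\<And>s. s \<in> S \<Longrightarrow> \<phi> (gen_class S R s) = h s"
proof -
  interpret H: group H by fact
  define \<phi> where "\<phi> C = word_val H h (SOME w. w \<in> C)" for C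
  have \<phi>: "\<phi> (word_rel S R `` {w}) = word_val H h w" if "w \<in> words S" for w
  proof -
    have "w \<in> word_rel S R `` {w}"
      using that by (simp add: word_rel_def word_eq.refl)
    then have "(SOME v. v \<in> word_rel S R `` {w}) \<in> word_rel S R `` {w}"
      by (rule someI)
    then show ?thesis
      using H.word_val_word_eq[OF h rel] by (simp add: \<phi>_def word_rel_def)
  qed
  show ?thesis
  proof
    show "\<phi> \<in> hom (presented_group S R) H"
      by (rule homI)
        (auto simp: carrier_presented_group \<phi> H.word_val_closed[OF h] mult_presented_group_class
          append_in_words H.word_val_append[OF h])
    show "\<phi> (gen_class S R s) = h s" if "s \<in> S" for s
      using that by (simp add: gen_class_def \<phi> H.word_val_letter[OF h])
  qed
qed

lemma hom_presented_group_word: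
  assumes "group H" "\<phi> \<in> hom (presented_group S R) H" "w \<in> words S"
  shows "\<phi> (word_rel S R `` {w}) = word_val H (\<lambda>s. \<phi> (gen_class S R s)) w"
proof -
  interpret group_hom "presented_group S R" H \<phi>
    by (intro group_hom.intro group_hom_axioms.intro assms group_presented_group)
  have *: "gen_class S R \<in> S \<rightarrow> carrier (presented_group S R)" by simp
  have "\<phi> (word_val (presented_group S R) (gen_class S R) w) = word_val H (\<lambda>s. \<phi> (gen_class S R s)) w"
    using assms(3) by (induction rule: words_induct) (auto simp: G.word_val_closed[OF *])
  then show ?thesis
    by (simp add: word_val_gen_class assms(3))
qed

lemma hom_presented_group_eqI:
  assumes "group H" "\<phi> \<in> hom (presented_group S R) H" "\<psi> \<in> hom (presented_group S R) H"
    and "\<And>s. s \<in> S \<Longrightarrow> \<phi> (gen_class S R s) = \<psi> (gen_class S R s)"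
    and "x \<in> carrier (presented_group S R)"
  shows "\<phi> x = \<psi> x"
  using assms(5) word_val_cong[OF _ assms(4)]
  by (auto simp: carrier_presented_group hom_presented_group_word[OF assms(1,2)]
      hom_presented_group_word[OF assms(1,3)])


section \<open>The twisted product of a cocycle\<close>

text \<open>The total group of the central extension of \<open>G\<close> by \<open>M\<close> with
  factor set \<alpha>. The cocycle is not assumed normalised, so the identity carries the inverse of
  \<alpha>(1,1).\<close>

definition twisted_product ::
    "('g, 'c) monoid_scheme \<Rightarrow> ('m, 'd) monoid_scheme \<Rightarrow> ('g \<times> 'g \<Rightarrow> 'm) \<Rightarrow> ('m \<times> 'g) monoid"
  where "twisted_product G M \<alpha> =
    \<lparr>carrier = carrier M \<times> carrier G,
     monoid.mult = (\<lambda>(a, g) (b, h). (a \<otimes>\<^bsub>M\<^esub> b \<otimes>\<^bsub>M\<^esub> \<alpha> (g, h), g \<otimes>\<^bsub>G\<^esub> h)),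
     one = (inv\<^bsub>M\<^esub> \<alpha> (\<one>\<^bsub>G\<^esub>, \<one>\<^bsub>G\<^esub>), \<one>\<^bsub>G\<^esub>)\<rparr>"

locale cocycle = G: group G + M: comm_group M
  for G :: "('g, 'c) monoid_scheme" and M :: "('m, 'd) monoid_scheme" and \<alpha> +
  assumes cocycle: "\<alpha> \<in> cocycles2 G M"
begin

abbreviation T where "T \<equiv> twisted_product G M \<alpha>"

lemma cocycle_closed [simp]: "g \<in> carrier G \<Longrightarrow> h \<in> carrier G \<Longrightarrow> \<alpha> (g, h) \<in> carrier M"
  using cocycle by (auto simp: cocycles2_def PiE_iff)

lemma cocycle_eq:
  "g \<in> carrier G \<Longrightarrow> h \<in> carrier G \<Longrightarrow> k \<in> carrier G \<Longrightarrow>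
    \<alpha> (g, h) \<otimes>\<^bsub>M\<^esub> \<alpha> (g \<otimes>\<^bsub>G\<^esub> h, k) = \<alpha> (h, k) \<otimes>\<^bsub>M\<^esub> \<alpha> (g, h \<otimes>\<^bsub>G\<^esub> k)"
  using cocycle by (simp add: cocycles2_def)

definition \<epsilon> where "\<epsilon> = \<alpha> (\<one>\<^bsub>G\<^esub>, \<one>\<^bsub>G\<^esub>)"

lemma \<epsilon>_closed [simp]: "\<epsilon> \<in> carrier M"
  by (simp add: \<epsilon>_def)

text \<open>The cocycle identity at (1,1,g) reads \<alpha>(1,1) \<alpha>(1,g) = \<alpha>(1,g)
  \<alpha>(1,g); cancel one factor.\<close>

lemma cocycle_one_left: "g \<in> carrier G \<Longrightarrow> \<alpha> (\<one>\<^bsub>G\<^esub>, g) = \<epsilon>"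
  using cocycle_eq[of "\<one>\<^bsub>G\<^esub>" "\<one>\<^bsub>G\<^esub>" g] by (simp add: \<epsilon>_def)

lemma cocycle_one_right: "g \<in> carrier G \<Longrightarrow> \<alpha> (g, \<one>\<^bsub>G\<^esub>) = \<epsilon>"
  using cocycle_eq[of g "\<one>\<^bsub>G\<^esub>" "\<one>\<^bsub>G\<^esub>"] by (simp add: \<epsilon>_def)

lemma twisted_carrier [simp]: "(a, g) \<in> carrier T \<longleftrightarrow> a \<in> carrier M \<and> g \<in> carrier G"
  by (simp add: twisted_product_def)

lemma twisted_mult [simp]:
  "(a, g) \<otimes>\<^bsub>T\<^esub> (b, h) = (a \<otimes>\<^bsub>M\<^esub> b \<otimes>\<^bsub>M\<^esub> \<alpha> (g, h), g \<otimes>\<^bsub>G\<^esub> h)"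
  by (simp add: twisted_product_def)

lemma twisted_one: "\<one>\<^bsub>T\<^esub> = (inv\<^bsub>M\<^esub> \<epsilon>, \<one>\<^bsub>G\<^esub>)"
  by (simp add: twisted_product_def \<epsilon>_def)

lemma group_twisted_product: "group T"
proof (rule groupI)
  fix x y z assume "x \<in> carrier T" "y \<in> carrier T" "z \<in> carrier T"
  then obtain a g b h c k where xyz: "x = (a, g)" "y = (b, h)" "z = (c, k)"
    and mem: "a \<in> carrier M" "b \<in> carrier M" "c \<in> carrier M"
      "g \<in> carrier G" "h \<in> carrier G" "k \<in> carrier G"
    by (cases x, cases y, cases z) auto
  show "x \<otimes>\<^bsub>T\<^esub> y \<in> carrier T" using mem by (simp add: xyz)
  \<comment> \<open>Up to reordering in \<open>M\<close>, associativity in the first coordinate is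
    the cocycle identity.\<close>
  have "a \<otimes>\<^bsub>M\<^esub> b \<otimes>\<^bsub>M\<^esub> c \<otimes>\<^bsub>M\<^esub> (\<alpha> (g, h) \<otimes>\<^bsub>M\<^esub> \<alpha> (g \<otimes>\<^bsub>G\<^esub> h, k))
      = a \<otimes>\<^bsub>M\<^esub> b \<otimes>\<^bsub>M\<^esub> c \<otimes>\<^bsub>M\<^esub> (\<alpha> (h, k) \<otimes>\<^bsub>M\<^esub> \<alpha> (g, h \<otimes>\<^bsub>G\<^esub> k))"
    using mem by (simp add: cocycle_eq)
  then show "x \<otimes>\<^bsub>T\<^esub> y \<otimes>\<^bsub>T\<^esub> z = x \<otimes>\<^bsub>T\<^esub> (y \<otimes>\<^bsub>T\<^esub> z)"
    using mem by (simp add: xyz G.m_assoc M.m_ac)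
  show "\<one>\<^bsub>T\<^esub> \<otimes>\<^bsub>T\<^esub> x = x"
    using mem by (simp add: xyz twisted_one cocycle_one_left M.m_ac)
  \<comment> \<open>The first coordinate u of the left inverse solves u a \<alpha>(g^-1,g) =
    \<epsilon>^-1.\<close>
  let ?y = "(inv\<^bsub>M\<^esub> (a \<otimes>\<^bsub>M\<^esub> \<alpha> (inv\<^bsub>G\<^esub> g, g) \<otimes>\<^bsub>M\<^esub> \<epsilon>), inv\<^bsub>G\<^esub> g)"
  have "inv\<^bsub>M\<^esub> (u \<otimes>\<^bsub>M\<^esub> v \<otimes>\<^bsub>M\<^esub> w) \<otimes>\<^bsub>M\<^esub> u \<otimes>\<^bsub>M\<^esub> v = inv\<^bsub>M\<^esub> w"
    if "u \<in> carrier M" "v \<in> carrier M" "w \<in> carrier M" for u v w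
    using that M.inv_mult_group[of "u \<otimes>\<^bsub>M\<^esub> v" w] by (simp add: M.m_assoc)
  then have "?y \<otimes>\<^bsub>T\<^esub> x = \<one>\<^bsub>T\<^esub>"
    using mem by (simp add: xyz twisted_one)
  then show "\<exists>y\<in>carrier T. y \<otimes>\<^bsub>T\<^esub> x = \<one>\<^bsub>T\<^esub>"
    using mem by (intro bexI[of _ ?y]) auto
qed (simp add: twisted_one)

lemma snd_hom_twisted: "snd \<in> hom T G"
  by (rule homI) (auto simp: twisted_product_def)

text \<open>The embedding of \<open>M\<close> as the kernel of \<open>snd\<close>. The factor
  \<epsilon>^-1 cancels \<alpha>(1,g) = \<epsilon>, so that \<open>scalar a\<close> multiplies the
  first coordinate by exactly \<open>a\<close>.\<close>

definition scalar :: "'m \<Rightarrow> 'm \<times> 'g"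
  where "scalar a = (a \<otimes>\<^bsub>M\<^esub> inv\<^bsub>M\<^esub> \<epsilon>, \<one>\<^bsub>G\<^esub>)"

lemma scalar_hom: "scalar \<in> hom M T"
proof -
  have "\<epsilon> \<otimes>\<^bsub>M\<^esub> (inv\<^bsub>M\<^esub> \<epsilon> \<otimes>\<^bsub>M\<^esub> inv\<^bsub>M\<^esub> \<epsilon>) = inv\<^bsub>M\<^esub> \<epsilon>"
    by (simp flip: M.m_assoc)
  then show ?thesis
    by (intro homI) (auto simp: scalar_def cocycle_one_left M.m_ac)
qed

lemma scalar_mult:
  "a \<in> carrier M \<Longrightarrow> b \<in> carrier M \<Longrightarrow> g \<in> carrier G \<Longrightarrow> scalar a \<otimes>\<^bsub>T\<^esub> (b, g) = (a \<otimes>\<^bsub>M\<^esub> b, g)"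
  by (simp add: scalar_def cocycle_one_left M.m_ac)

text \<open>Products with an element over the identity involve only the cocycle values \<alpha>(1,g)
  and \<alpha>(g,1), and both equal \<epsilon>.\<close>

lemma twisted_central:
  assumes "x \<in> carrier T" "snd x = \<one>\<^bsub>G\<^esub>" "y \<in> carrier T"
  shows "x \<otimes>\<^bsub>T\<^esub> y = y \<otimes>\<^bsub>T\<^esub> x"
  using assms by (cases x; cases y) (auto simp: cocycle_one_left cocycle_one_right M.m_ac)

lemma scalar_cases:
  assumes "x \<in> carrier T" "snd x = \<one>\<^bsub>G\<^esub>"
  obtains a where "a \<in> carrier M" "x = scalar a"
proof
  show "fst x \<otimes>\<^bsub>M\<^esub> \<epsilon> \<in> carrier M"
    using assms by (cases x) auto
  show "x = scalar (fst x \<otimes>\<^bsub>M\<^esub> \<epsilon>)"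
    using assms by (cases x) (auto simp: scalar_def M.m_assoc)
qed

text \<open>Rescaling a lift \<open>(a, g)\<close> by a scalar \<open>c\<close> multiplies its \<open>m\<close>-th power, which is a scalar, by \<open>c\<^sup>m\<close>.\<close>

lemma lift_same_order:
  fixes m :: int
  assumes div: "\<And>b. b \<in> carrier M \<Longrightarrow> m \<noteq> 0 \<Longrightarrow> \<exists>c\<in>carrier M. c [^]\<^bsub>M\<^esub> m = b"
    and g: "g \<in> carrier G" "g [^]\<^bsub>G\<^esub> m = \<one>\<^bsub>G\<^esub>"
  obtains y where "y \<in> carrier T" "snd y = g" "y [^]\<^bsub>T\<^esub> m = \<one>\<^bsub>T\<^esub>"
proof -
  interpret T: group T by (rule group_twisted_product)
  interpret p: group_hom T G snd
    by (intro group_hom.intro group_hom_axioms.intro T.is_group G.is_group snd_hom_twisted)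
  interpret s: group_hom M T scalar
    by (intro group_hom.intro group_hom_axioms.intro T.is_group M.is_group scalar_hom)
  define x where "x = (\<one>\<^bsub>M\<^esub>, g)"
  have x: "x \<in> carrier T" "snd x = g" using g by (auto simp: x_def)
  show ?thesis
  proof (cases "m = 0")
    case True
    then show ?thesis using that[of x] x by simp
  next
    case False
    have "x [^]\<^bsub>T\<^esub> m \<in> carrier T" "snd (x [^]\<^bsub>T\<^esub> m) = \<one>\<^bsub>G\<^esub>"
      using x g p.hom_int_pow[of x m] by simp_all
    then obtain b where b: "b \<in> carrier M" "x [^]\<^bsub>T\<^esub> m = scalar b"
      by (rule scalar_cases)
    \<comment> \<open>An m-th root of the inverse of \<open>b\<close>, so that
      \<open>scalar c\<close> cancels the power of \<open>x\<close>.\<close>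
    obtain c where c: "c \<in> carrier M" "c [^]\<^bsub>M\<^esub> m = inv\<^bsub>M\<^esub> b"
      using div[of "inv\<^bsub>M\<^esub> b"] b False by auto
    have sc: "scalar c \<in> carrier T" using c by simp
    have "(scalar c \<otimes>\<^bsub>T\<^esub> x) [^]\<^bsub>T\<^esub> m = scalar c [^]\<^bsub>T\<^esub> m \<otimes>\<^bsub>T\<^esub> x [^]\<^bsub>T\<^esub> m"
      using x sc by (intro T.int_pow_mult_distrib twisted_central) (auto simp: scalar_def)
    also have "scalar c [^]\<^bsub>T\<^esub> m = scalar (inv\<^bsub>M\<^esub> b)"
      using c s.hom_int_pow[of c m] by simp
    finally have "(scalar c \<otimes>\<^bsub>T\<^esub> x) [^]\<^bsub>T\<^esub> m = \<one>\<^bsub>T\<^esub>"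
      using b by simp
    moreover have "snd (scalar c \<otimes>\<^bsub>T\<^esub> x) = g"
      using x sc g p.hom_mult[OF sc x(1)] by (simp add: scalar_def)
    ultimately show ?thesis using that sc x by blast
  qed
qed

end


section \<open>The transgression map\<close>

lemma (in group) hom_derived_trivial:
  assumes "comm_group M" "f \<in> hom G M" "x \<in> derived G (carrier G)"
  shows "f x = \<one>\<^bsub>M\<^esub>"
proof -
  interpret M: comm_group M by fact
  interpret f: group_hom G M f
    by (intro group_hom.intro group_hom_axioms.intro assms is_group M.is_group)
  have "f (a \<otimes> b \<otimes> inv a \<otimes> inv b) = \<one>\<^bsub>M\<^esub>" if ab: "a \<in> carrier G" "b \<in> carrier G" for a b
  proof -
    have "f (a \<otimes> b \<otimes> inv a \<otimes> inv b) = (f b \<otimes>\<^bsub>M\<^esub> f a) \<otimes>\<^bsub>M\<^esub> inv\<^bsub>M\<^esub> (f b \<otimes>\<^bsub>M\<^esub> f a)"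
      using ab M.m_comm[of "f a" "f b"] by (simp add: M.inv_mult_group flip: M.m_assoc)
    then show ?thesis using ab by simp
  qed
  then have "derived_set G (carrier G) \<subseteq> kernel G M f"
    by (auto simp: kernel_def)
  then have "derived G (carrier G) \<subseteq> kernel G M f"
    unfolding derived_def by (rule generate_subgroup_incl[OF _ f.subgroup_kernel])
  then show ?thesis using assms(3) by (auto simp: kernel_def)
qed

text \<open>The section \<mu> is arbitrary; in particular \<mu>(1) may differ from 1, which causes
  the correction term in \<open>rho_iota\<close>.\<close>

locale sectioned_central_extension = M: comm_group M
  for A :: "('a, 'b) monoid_scheme" and \<iota> and E :: "('e, 'c) monoid_scheme" and \<pi>
    and G :: "('g, 'd) monoid_scheme" and M :: "('m, 'f) monoid_scheme" and \<mu> +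
  assumes ext: "central_extension A \<iota> E \<pi> G" and section_mu: "is_section E \<pi> G \<mu>"
begin

sublocale A: group A using ext by (simp add: central_extension_def)
sublocale E: group E using ext by (simp add: central_extension_def)
sublocale G: group G using ext by (simp add: central_extension_def)
sublocale \<pi>: group_hom E G \<pi>
  using ext by unfold_locales (auto simp: central_extension_def epi_def)
sublocale \<iota>: group_hom A E \<iota>
  using ext by unfold_locales (auto simp: central_extension_def mon_def)

lemma inj_iota: "inj_on \<iota> (carrier A)"
  using ext by (simp add: central_extension_def mon_def)

lemma iota_central: "a \<in> carrier A \<Longrightarrow> x \<in> carrier E \<Longrightarrow> x \<otimes>\<^bsub>E\<^esub> \<iota> a = \<iota> a \<otimes>\<^bsub>E\<^esub> x"
  using ext by (simp add: central_extension_def)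

lemma pi_iota [simp]: "a \<in> carrier A \<Longrightarrow> \<pi> (\<iota> a) = \<one>\<^bsub>G\<^esub>"
  using ext by (auto simp: central_extension_def kernel_def)

lemma mu_closed [simp]: "g \<in> carrier G \<Longrightarrow> \<mu> g \<in> carrier E"
  using section_mu by (auto simp: is_section_def)

lemma pi_mu [simp]: "g \<in> carrier G \<Longrightarrow> \<pi> (\<mu> g) = g"
  using section_mu by (auto simp: is_section_def)

definition \<beta> where "\<beta> = inv_into (carrier A) \<iota>"

lemma beta:
  assumes "x \<in> carrier E" "\<pi> x = \<one>\<^bsub>G\<^esub>"
  shows "\<beta> x \<in> carrier A" "\<iota> (\<beta> x) = x"
proof -
  have "x \<in> \<iota> ` carrier A"
    using assms ext by (auto simp: central_extension_def kernel_def)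
  then show "\<beta> x \<in> carrier A" "\<iota> (\<beta> x) = x"
    unfolding \<beta>_def by (auto simp: inv_into_into f_inv_into_f)
qed

text \<open>The factor set of the extension relative to \<mu>, read in \<open>A\<close>; the
  transgression of \<open>f\<close> is represented by \<open>f\<close> composed with
  \<delta>.\<close>

definition \<delta> where "\<delta> g h = \<beta> (\<mu> g \<otimes>\<^bsub>E\<^esub> \<mu> h \<otimes>\<^bsub>E\<^esub> inv\<^bsub>E\<^esub> \<mu> (g \<otimes>\<^bsub>G\<^esub> h))"

text \<open>The \<open>A\<close>-coordinate of \<open>x\<close> relative to \<mu>: \<open>x\<close>
  is \<open>\<iota> (\<rho> x)\<close> times \<open>\<mu> (\<pi> x)\<close>, see
  \<open>rho_decomp\<close>.\<close>

definition \<rho> where "\<rho> x = \<beta> (x \<otimes>\<^bsub>E\<^esub> inv\<^bsub>E\<^esub> \<mu> (\<pi> x))"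

lemma delta_closed [simp]: "g \<in> carrier G \<Longrightarrow> h \<in> carrier G \<Longrightarrow> \<delta> g h \<in> carrier A"
  by (simp add: \<delta>_def beta)

lemma rho_closed [simp]: "x \<in> carrier E \<Longrightarrow> \<rho> x \<in> carrier A"
  by (simp add: \<rho>_def beta)

lemma mu_mult:
  "g \<in> carrier G \<Longrightarrow> h \<in> carrier G \<Longrightarrow> \<mu> g \<otimes>\<^bsub>E\<^esub> \<mu> h = \<iota> (\<delta> g h) \<otimes>\<^bsub>E\<^esub> \<mu> (g \<otimes>\<^bsub>G\<^esub> h)"
  using beta(2)[of "\<mu> g \<otimes>\<^bsub>E\<^esub> \<mu> h \<otimes>\<^bsub>E\<^esub> inv\<^bsub>E\<^esub> \<mu> (g \<otimes>\<^bsub>G\<^esub> h)"]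
  by (simp add: \<delta>_def) (simp add: E.m_assoc)

lemma rho_decomp: "x \<in> carrier E \<Longrightarrow> \<iota> (\<rho> x) \<otimes>\<^bsub>E\<^esub> \<mu> (\<pi> x) = x"
  by (simp add: \<rho>_def beta E.m_assoc)

text \<open>Cancellation of \<open>\<mu> g\<close> and injectivity of \<iota>. It lets identities in
  \<open>A\<close> be proved by computing in \<open>E\<close>.\<close>

lemma decomp_unique:
  assumes "a \<in> carrier A" "b \<in> carrier A" "g \<in> carrier G"
    and "\<iota> a \<otimes>\<^bsub>E\<^esub> \<mu> g = \<iota> b \<otimes>\<^bsub>E\<^esub> \<mu> g"
  shows "a = b"
  by (rule inj_onD[OF inj_iota]) (use assms in auto)

text \<open>Compare the two bracketings of \<open>\<mu> g\<close>, \<open>\<mu> h\<close>,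
  \<open>\<mu> k\<close> in \<open>E\<close>; each gives a central factor times the section value at
  the triple product.\<close>

lemma delta_cocycle:
  assumes "g \<in> carrier G" "h \<in> carrier G" "k \<in> carrier G"
  shows "\<delta> g h \<otimes>\<^bsub>A\<^esub> \<delta> (g \<otimes>\<^bsub>G\<^esub> h) k = \<delta> h k \<otimes>\<^bsub>A\<^esub> \<delta> g (h \<otimes>\<^bsub>G\<^esub> k)"
proof (rule decomp_unique)
  have "\<iota> (\<delta> g h \<otimes>\<^bsub>A\<^esub> \<delta> (g \<otimes>\<^bsub>G\<^esub> h) k) \<otimes>\<^bsub>E\<^esub> \<mu> (g \<otimes>\<^bsub>G\<^esub> h \<otimes>\<^bsub>G\<^esub> k) = (\<mu> g \<otimes>\<^bsub>E\<^esub> \<mu> h) \<otimes>\<^bsub>E\<^esub> \<mu> k"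
    using assms by (simp add: mu_mult E.m_assoc)
  also have "\<dots> = \<mu> g \<otimes>\<^bsub>E\<^esub> (\<mu> h \<otimes>\<^bsub>E\<^esub> \<mu> k)"
    using assms by (simp add: E.m_assoc)
  also have "\<dots> = (\<mu> g \<otimes>\<^bsub>E\<^esub> \<iota> (\<delta> h k)) \<otimes>\<^bsub>E\<^esub> \<mu> (h \<otimes>\<^bsub>G\<^esub> k)"
    using assms by (simp add: mu_mult E.m_assoc)
  also have "\<dots> = \<iota> (\<delta> h k) \<otimes>\<^bsub>E\<^esub> (\<mu> g \<otimes>\<^bsub>E\<^esub> \<mu> (h \<otimes>\<^bsub>G\<^esub> k))"
    using assms iota_central[of "\<delta> h k" "\<mu> g"] by (simp add: E.m_assoc)
  also have "\<dots> = \<iota> (\<delta> h k \<otimes>\<^bsub>A\<^esub> \<delta> g (h \<otimes>\<^bsub>G\<^esub> k)) \<otimes>\<^bsub>E\<^esub> \<mu> (g \<otimes>\<^bsub>G\<^esub> h \<otimes>\<^bsub>G\<^esub> k)"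
    using assms by (simp add: mu_mult E.m_assoc G.m_assoc)
  finally show "\<iota> (\<delta> g h \<otimes>\<^bsub>A\<^esub> \<delta> (g \<otimes>\<^bsub>G\<^esub> h) k) \<otimes>\<^bsub>E\<^esub> \<mu> (g \<otimes>\<^bsub>G\<^esub> h \<otimes>\<^bsub>G\<^esub> k)
      = \<iota> (\<delta> h k \<otimes>\<^bsub>A\<^esub> \<delta> g (h \<otimes>\<^bsub>G\<^esub> k)) \<otimes>\<^bsub>E\<^esub> \<mu> (g \<otimes>\<^bsub>G\<^esub> h \<otimes>\<^bsub>G\<^esub> k)" .
qed (use assms in auto)

text \<open>Multiply the decompositions of \<open>x\<close> and \<open>y\<close>, move the central
  factor of \<open>y\<close> to the left, and rewrite the product of section values by
  \<open>mu_mult\<close>.\<close>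

lemma rho_mult:
  assumes "x \<in> carrier E" "y \<in> carrier E"
  shows "\<rho> (x \<otimes>\<^bsub>E\<^esub> y) = \<rho> x \<otimes>\<^bsub>A\<^esub> \<rho> y \<otimes>\<^bsub>A\<^esub> \<delta> (\<pi> x) (\<pi> y)"
proof (rule decomp_unique)
  have "\<iota> (\<rho> (x \<otimes>\<^bsub>E\<^esub> y)) \<otimes>\<^bsub>E\<^esub> \<mu> (\<pi> x \<otimes>\<^bsub>G\<^esub> \<pi> y)
      = (\<iota> (\<rho> x) \<otimes>\<^bsub>E\<^esub> \<mu> (\<pi> x)) \<otimes>\<^bsub>E\<^esub> (\<iota> (\<rho> y) \<otimes>\<^bsub>E\<^esub> \<mu> (\<pi> y))"
    using assms rho_decomp[of "x \<otimes>\<^bsub>E\<^esub> y"] by (simp add: rho_decomp)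
  also have "\<dots> = \<iota> (\<rho> x) \<otimes>\<^bsub>E\<^esub> (\<mu> (\<pi> x) \<otimes>\<^bsub>E\<^esub> \<iota> (\<rho> y)) \<otimes>\<^bsub>E\<^esub> \<mu> (\<pi> y)"
    using assms by (simp add: E.m_assoc)
  also have "\<dots> = \<iota> (\<rho> x) \<otimes>\<^bsub>E\<^esub> \<iota> (\<rho> y) \<otimes>\<^bsub>E\<^esub> (\<mu> (\<pi> x) \<otimes>\<^bsub>E\<^esub> \<mu> (\<pi> y))"
    using assms iota_central[of "\<rho> y" "\<mu> (\<pi> x)"] by (simp add: E.m_assoc)
  also have "\<dots> = \<iota> (\<rho> x \<otimes>\<^bsub>A\<^esub> \<rho> y \<otimes>\<^bsub>A\<^esub> \<delta> (\<pi> x) (\<pi> y)) \<otimes>\<^bsub>E\<^esub> \<mu> (\<pi> x \<otimes>\<^bsub>G\<^esub> \<pi> y)"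
    using assms by (simp add: mu_mult E.m_assoc)
  finally show "\<iota> (\<rho> (x \<otimes>\<^bsub>E\<^esub> y)) \<otimes>\<^bsub>E\<^esub> \<mu> (\<pi> x \<otimes>\<^bsub>G\<^esub> \<pi> y)
      = \<iota> (\<rho> x \<otimes>\<^bsub>A\<^esub> \<rho> y \<otimes>\<^bsub>A\<^esub> \<delta> (\<pi> x) (\<pi> y)) \<otimes>\<^bsub>E\<^esub> \<mu> (\<pi> x \<otimes>\<^bsub>G\<^esub> \<pi> y)" .
qed (use assms in auto)

text \<open>The value of \<rho> at the identity corresponds to the inverse of \<mu>(1); it is
  trivial only for a section with \<mu>(1) = 1.\<close>

lemma rho_iota:
  assumes "a \<in> carrier A"
  shows "\<rho> (\<iota> a) = a \<otimes>\<^bsub>A\<^esub> \<rho> \<one>\<^bsub>E\<^esub>"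
proof (rule decomp_unique)
  have "\<iota> (\<rho> (\<iota> a)) \<otimes>\<^bsub>E\<^esub> \<mu> \<one>\<^bsub>G\<^esub> = \<iota> a \<otimes>\<^bsub>E\<^esub> (\<iota> (\<rho> \<one>\<^bsub>E\<^esub>) \<otimes>\<^bsub>E\<^esub> \<mu> \<one>\<^bsub>G\<^esub>)"
    using assms rho_decomp[of "\<iota> a"] rho_decomp[of "\<one>\<^bsub>E\<^esub>"] by simp
  then show "\<iota> (\<rho> (\<iota> a)) \<otimes>\<^bsub>E\<^esub> \<mu> \<one>\<^bsub>G\<^esub> = \<iota> (a \<otimes>\<^bsub>A\<^esub> \<rho> \<one>\<^bsub>E\<^esub>) \<otimes>\<^bsub>E\<^esub> \<mu> \<one>\<^bsub>G\<^esub>"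
    using assms by (simp add: E.m_assoc)
qed (use assms in auto)

section \<open>The transgression as a map into the second cohomology group\<close>

lemma transgression_cocycle_eq:
  "transgression_cocycle A \<iota> E G \<mu> f = (\<lambda>(g, h)\<in>carrier G \<times> carrier G. f (\<delta> g h))"
  by (simp add: transgression_cocycle_def \<delta>_def \<beta>_def)

abbreviation Z2 where "Z2 \<equiv> cocycle_group2 G M"
abbreviation B2 where "B2 \<equiv> coboundaries2 G M"
abbreviation tra where "tra \<equiv> transgression A \<iota> E G M \<mu>"
abbreviation tra_cocycle where "tra_cocycle \<equiv> transgression_cocycle A \<iota> E G \<mu>"

lemma carrier_Z2: "carrier Z2 = cocycles2 G M"
  by (simp add: cocycle_group2_def)

sublocale Z2: comm_group Z2
  by (rule comm_group_cocycle_group2[OF G.is_group M.comm_group_axioms])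

sublocale B2: normal B2 Z2
  by (rule Z2.subgroup_imp_normal[OF subgroup_coboundaries2[OF G.is_group M.comm_group_axioms]])

lemma tra_cocycle_closed:
  assumes "f \<in> hom A M"
  shows "tra_cocycle f \<in> carrier Z2"
proof -
  interpret f: group_hom A M f
    by (intro group_hom.intro group_hom_axioms.intro assms A.is_group M.is_group)
  have "f (\<delta> g h) \<otimes>\<^bsub>M\<^esub> f (\<delta> (g \<otimes>\<^bsub>G\<^esub> h) k) = f (\<delta> h k) \<otimes>\<^bsub>M\<^esub> f (\<delta> g (h \<otimes>\<^bsub>G\<^esub> k))"
    if "g \<in> carrier G" "h \<in> carrier G" "k \<in> carrier G" for g h k
    using that delta_cocycle[OF that] by (simp flip: f.hom_mult)
  then show ?thesis
    by (auto simp: carrier_Z2 cocycles2_def transgression_cocycle_eq)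
qed

lemma tra_cocycle_mult:
  assumes "f \<in> hom A M" "f' \<in> hom A M"
  shows "tra_cocycle (f \<otimes>\<^bsub>hom_group A M\<^esub> f') = tra_cocycle f \<otimes>\<^bsub>Z2\<^esub> tra_cocycle f'"
  by (auto simp: transgression_cocycle_eq cocycle_group2_def hom_group_def intro!: restrict_ext)

lemma transgression_hom: "tra \<in> hom (hom_group A M) (H2 G M)"
proof (rule homI)
  fix f f' assume "f \<in> carrier (hom_group A M)" "f' \<in> carrier (hom_group A M)"
  then have f: "f \<in> hom A M" "f' \<in> hom A M" by (simp_all add: hom_group_def)
  show "tra f \<in> carrier (H2 G M)"
    using tra_cocycle_closed[OF f(1)] by (auto simp: transgression_def H2_def carrier_FactGroup)
  show "tra (f \<otimes>\<^bsub>hom_group A M\<^esub> f') = tra f \<otimes>\<^bsub>H2 G M\<^esub> tra f'"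
    using f by (simp add: transgression_def H2_def tra_cocycle_mult B2.rcos_sum tra_cocycle_closed)
qed

text \<open>If the classes of \<open>f\<close> and \<open>f'\<close> differ by the coboundary of \<open>c\<close>, then
  \<open>x \<mapsto> (f'/f)(\<rho> x) c(\<pi> x)\<close> is a homomorphism on \<open>E\<close>; it is trivial on commutators.\<close>

lemma transgression_inj:
  assumes der: "\<iota> ` carrier A \<subseteq> derived E (carrier E)"
  shows "inj_on tra (carrier (hom_group A M))"
proof (rule inj_onI)
  fix f f' assume f: "f \<in> carrier (hom_group A M)" and f': "f' \<in> carrier (hom_group A M)"
    and eq: "tra f = tra f'"
  interpret f: group_hom A M f
    using f by unfold_locales (simp add: hom_group_def)
  interpret f': group_hom A M f'
    using f' by unfold_locales (simp add: hom_group_def)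
  \<comment> \<open>Equal classes place the cocycle of \<open>f'\<close> in the coset of the cocycle
    of \<open>f\<close>, and membership in that coset supplies \<open>c\<close>.\<close>
  have "tra_cocycle f' \<in> B2 #>\<^bsub>Z2\<^esub> tra_cocycle f'"
    by (rule Z2.rcos_self[OF tra_cocycle_closed[OF f'.homh] B2.subgroup_axioms])
  then have "tra_cocycle f' \<in> B2 #>\<^bsub>Z2\<^esub> tra_cocycle f"
    using eq by (simp add: transgression_def)
  then obtain c where c: "c \<in> carrier G \<rightarrow> carrier M"
    and tc: "tra_cocycle f' = coboundary2 G M c \<otimes>\<^bsub>Z2\<^esub> tra_cocycle f"
    by (auto simp: r_coset_def coboundaries2_def)
  have cM [simp]: "c g \<in> carrier M" if "g \<in> carrier G" for g
    using c that by auto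
  define q where "q a = f' a \<otimes>\<^bsub>M\<^esub> inv\<^bsub>M\<^esub> f a" for a
  have q_closed [simp]: "q a \<in> carrier M" if "a \<in> carrier A" for a
    using that by (simp add: q_def)
  have q_mult: "q (a \<otimes>\<^bsub>A\<^esub> b) = q a \<otimes>\<^bsub>M\<^esub> q b" if "a \<in> carrier A" "b \<in> carrier A" for a b
    using that by (simp add: q_def M.inv_mult M.m_ac)
  have q_delta: "q (\<delta> g h) \<otimes>\<^bsub>M\<^esub> c (g \<otimes>\<^bsub>G\<^esub> h) = c g \<otimes>\<^bsub>M\<^esub> c h"
    if g: "g \<in> carrier G" "h \<in> carrier G" for g h
  proof -
    have "f' (\<delta> g h) = c g \<otimes>\<^bsub>M\<^esub> c h \<otimes>\<^bsub>M\<^esub> inv\<^bsub>M\<^esub> c (g \<otimes>\<^bsub>G\<^esub> h) \<otimes>\<^bsub>M\<^esub> f (\<delta> g h)"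
      using fun_cong[OF tc, of "(g, h)"] g
      by (simp add: transgression_cocycle_eq coboundary2_def cocycle_group2_def)
    then show ?thesis
      using g by (simp add: q_def M.m_assoc)
  qed
  define F where "F x = q (\<rho> x) \<otimes>\<^bsub>M\<^esub> c (\<pi> x)" for x
  have F: "F \<in> hom E M"
  proof (rule homI)
    fix x y assume xy: "x \<in> carrier E" "y \<in> carrier E"
    have "F (x \<otimes>\<^bsub>E\<^esub> y) = q (\<rho> x) \<otimes>\<^bsub>M\<^esub> q (\<rho> y) \<otimes>\<^bsub>M\<^esub> (q (\<delta> (\<pi> x) (\<pi> y)) \<otimes>\<^bsub>M\<^esub> c (\<pi> x \<otimes>\<^bsub>G\<^esub> \<pi> y))"
      using xy by (simp add: F_def rho_mult q_mult M.m_assoc)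
    also have "\<dots> = q (\<rho> x) \<otimes>\<^bsub>M\<^esub> q (\<rho> y) \<otimes>\<^bsub>M\<^esub> (c (\<pi> x) \<otimes>\<^bsub>M\<^esub> c (\<pi> y))"
      using xy by (simp add: q_delta)
    also have "\<dots> = F x \<otimes>\<^bsub>M\<^esub> F y"
      using xy by (simp add: F_def M.m_ac)
    finally show "F (x \<otimes>\<^bsub>E\<^esub> y) = F x \<otimes>\<^bsub>M\<^esub> F y" .
  qed (simp add: F_def)
  interpret F: group_hom E M F
    by (intro group_hom.intro group_hom_axioms.intro E.is_group M.is_group F)
  have "f a = f' a" if a: "a \<in> carrier A" for a
  proof -
    have "\<one>\<^bsub>M\<^esub> = F (\<iota> a)"
      using E.hom_derived_trivial[OF M.comm_group_axioms F, of "\<iota> a"] der a by auto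
    \<comment> \<open>Since \<pi> kills \<open>\<iota> a\<close>, the correction from
      \<open>rho_iota\<close> combines with \<open>c\<close> at the identity into the value of the
      homomorphism \<open>F\<close> at 1, which is 1.\<close>
    also have "\<dots> = q a \<otimes>\<^bsub>M\<^esub> F \<one>\<^bsub>E\<^esub>"
      using a unfolding F_def by (simp add: rho_iota q_mult M.m_assoc)
    finally have "f' a \<otimes>\<^bsub>M\<^esub> inv\<^bsub>M\<^esub> f a = \<one>\<^bsub>M\<^esub>"
      using a by (simp add: q_def)
    then show ?thesis
      using a M.inv_equality[of "f' a" "inv\<^bsub>M\<^esub> f a"] by simp
  qed
  then show "f = f'"
    using f f' by (intro extensionalityI[of f "carrier A"]) (auto simp: hom_group_def)
qed

text \<open>The lift maps \<open>\<iota> a\<close> to a scalar, which defines \<open>f\<close>.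
  Applying the lift to both sides of \<open>mu_mult\<close> shows that \<open>f\<close> composed
  with \<delta> differs from \<alpha> by the coboundary of the first coordinate of the lift along
  \<mu>.\<close>

lemma transgression_surj:
  assumes lift: "\<And>\<alpha>. \<alpha> \<in> cocycles2 G M \<Longrightarrow>
    \<exists>\<phi>\<in>hom E (twisted_product G M \<alpha>). \<forall>x\<in>carrier E. snd (\<phi> x) = \<pi> x"
  shows "tra ` carrier (hom_group A M) = carrier (H2 G M)"
proof
  show "tra ` carrier (hom_group A M) \<subseteq> carrier (H2 G M)"
    using transgression_hom by (auto simp: hom_def)
  show "carrier (H2 G M) \<subseteq> tra ` carrier (hom_group A M)"
  proof
    fix C assume "C \<in> carrier (H2 G M)"
    then obtain \<alpha> where \<alpha>: "\<alpha> \<in> cocycles2 G M" and C: "C = B2 #>\<^bsub>Z2\<^esub> \<alpha>"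
      by (auto simp: H2_def carrier_FactGroup carrier_Z2)
    interpret \<alpha>: cocycle G M \<alpha>
      by unfold_locales (rule \<alpha>)
    interpret T: group \<alpha>.T by (rule \<alpha>.group_twisted_product)
    obtain \<phi> where \<phi>: "\<phi> \<in> hom E \<alpha>.T" and snd_\<phi>: "\<And>x. x \<in> carrier E \<Longrightarrow> snd (\<phi> x) = \<pi> x"
      using lift[OF \<alpha>] by auto
    interpret \<phi>: group_hom E \<alpha>.T \<phi>
      by (intro group_hom.intro group_hom_axioms.intro E.is_group T.is_group \<phi>)
    have fst_\<phi> [simp]: "fst (\<phi> x) \<in> carrier M" if "x \<in> carrier E" for x
      using \<phi>.hom_closed[OF that] by (cases "\<phi> x") auto
    have \<phi>_eq: "\<phi> x = (fst (\<phi> x), \<pi> x)" if "x \<in> carrier E" for x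
      using snd_\<phi>[OF that] by (cases "\<phi> x") simp
    \<comment> \<open>The factor \<epsilon> undoes the one in \<open>scalar\<close>, so that
      \<open>scalar (f a)\<close> is \<open>\<phi> (\<iota> a)\<close>. The restriction to
      \<open>carrier A\<close> makes \<open>f\<close> an element of
      \<open>hom_group\<close>.\<close>
    define f where "f = (\<lambda>a\<in>carrier A. fst (\<phi> (\<iota> a)) \<otimes>\<^bsub>M\<^esub> \<alpha>.\<epsilon>)"
    have scalar_f: "\<alpha>.scalar (f a) = \<phi> (\<iota> a)" if "a \<in> carrier A" for a
      using that \<phi>_eq[of "\<iota> a"] by (simp add: f_def \<alpha>.scalar_def M.m_assoc)
    have f_closed [simp]: "f a \<in> carrier M" if "a \<in> carrier A" for a
      using that by (simp add: f_def)
    have f_hom: "f \<in> hom A M"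
    proof (rule homI)
      fix a b assume ab: "a \<in> carrier A" "b \<in> carrier A"
      \<comment> \<open>As \<open>scalar\<close> is injective, multiplicativity can be checked in
        the twisted product.\<close>
      have "\<alpha>.scalar (f (a \<otimes>\<^bsub>A\<^esub> b)) = \<alpha>.scalar (f a \<otimes>\<^bsub>M\<^esub> f b)"
        using ab hom_mult[OF \<alpha>.scalar_hom, of "f a" "f b"] by (simp add: scalar_f)
      then show "f (a \<otimes>\<^bsub>A\<^esub> b) = f a \<otimes>\<^bsub>M\<^esub> f b"
        using ab by (simp add: \<alpha>.scalar_def)
    qed simp
    define c where "c g = fst (\<phi> (\<mu> g))" for g
    have c: "c \<in> carrier G \<rightarrow> carrier M" by (simp add: c_def)
    have c_closed [simp]: "c g \<in> carrier M" if "g \<in> carrier G" for g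
      using c that by auto
    have f_delta: "f (\<delta> g h) \<otimes>\<^bsub>M\<^esub> c (g \<otimes>\<^bsub>G\<^esub> h) = c g \<otimes>\<^bsub>M\<^esub> c h \<otimes>\<^bsub>M\<^esub> \<alpha> (g, h)"
      if g: "g \<in> carrier G" "h \<in> carrier G" for g h
    proof -
      have \<phi>_mu: "\<phi> (\<mu> k) = (c k, k)" if "k \<in> carrier G" for k
        using \<phi>_eq[of "\<mu> k"] that by (simp add: c_def)
      have "(c g \<otimes>\<^bsub>M\<^esub> c h \<otimes>\<^bsub>M\<^esub> \<alpha> (g, h), g \<otimes>\<^bsub>G\<^esub> h) = \<phi> (\<mu> g \<otimes>\<^bsub>E\<^esub> \<mu> h)"
        using g by (simp add: \<phi>_mu)
      also have "\<dots> = \<alpha>.scalar (f (\<delta> g h)) \<otimes>\<^bsub>\<alpha>.T\<^esub> (c (g \<otimes>\<^bsub>G\<^esub> h), g \<otimes>\<^bsub>G\<^esub> h)"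
        using g by (simp add: mu_mult scalar_f \<phi>_mu)
      also have "\<dots> = (f (\<delta> g h) \<otimes>\<^bsub>M\<^esub> c (g \<otimes>\<^bsub>G\<^esub> h), g \<otimes>\<^bsub>G\<^esub> h)"
        using g by (simp add: \<alpha>.scalar_mult)
      finally show ?thesis by simp
    qed
    have "tra_cocycle f = coboundary2 G M c \<otimes>\<^bsub>Z2\<^esub> \<alpha>"
    proof (rule extensionalityI[of _ "carrier G \<times> carrier G"])
      fix x assume "x \<in> carrier G \<times> carrier G"
      then obtain g h where x: "x = (g, h)" and g: "g \<in> carrier G" "h \<in> carrier G" by auto
      have "f (\<delta> g h) = (f (\<delta> g h) \<otimes>\<^bsub>M\<^esub> c (g \<otimes>\<^bsub>G\<^esub> h)) \<otimes>\<^bsub>M\<^esub> inv\<^bsub>M\<^esub> c (g \<otimes>\<^bsub>G\<^esub> h)"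
        using g by (simp add: M.m_assoc)
      also have "\<dots> = c g \<otimes>\<^bsub>M\<^esub> c h \<otimes>\<^bsub>M\<^esub> inv\<^bsub>M\<^esub> c (g \<otimes>\<^bsub>G\<^esub> h) \<otimes>\<^bsub>M\<^esub> \<alpha> (g, h)"
        using g unfolding f_delta[OF g] by (simp add: M.m_ac)
      finally show "tra_cocycle f x = (coboundary2 G M c \<otimes>\<^bsub>Z2\<^esub> \<alpha>) x"
        using g by (simp add: x transgression_cocycle_eq coboundary2_def cocycle_group2_def)
    qed (simp_all add: transgression_cocycle_eq cocycle_group2_def)
    then have "tra_cocycle f \<in> B2 #>\<^bsub>Z2\<^esub> \<alpha>"
      using c by (auto simp: r_coset_def coboundaries2_def)
    then have "B2 #>\<^bsub>Z2\<^esub> \<alpha> = B2 #>\<^bsub>Z2\<^esub> tra_cocycle f"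
      using \<alpha> by (intro Z2.repr_independence B2.subgroup_axioms) (simp_all add: carrier_Z2)
    then have "C = tra f"
      by (simp add: C transgression_def)
    moreover have "f \<in> carrier (hom_group A M)"
      using f_hom by (simp add: hom_group_def f_def)
    ultimately show "C \<in> tra ` carrier (hom_group A M)" by blast
  qed
qed

lemma transgression_iso:
  assumes "\<iota> ` carrier A \<subseteq> derived E (carrier E)"
    and "\<And>\<alpha>. \<alpha> \<in> cocycles2 G M \<Longrightarrow>
      \<exists>\<phi>\<in>hom E (twisted_product G M \<alpha>). \<forall>x\<in>carrier E. snd (\<phi> x) = \<pi> x"
  shows "tra \<in> iso (hom_group A M) (H2 G M)"
  by (simp add: iso_def bij_betw_def transgression_hom transgression_inj transgression_surj assms)

end


section \<open>The groups \<open>F\<^sub>n(r,t)\<close>\<close>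

definition commutator :: "('g, 'c) monoid_scheme \<Rightarrow> 'g \<Rightarrow> 'g \<Rightarrow> 'g"
  where "commutator H a b = a \<otimes>\<^bsub>H\<^esub> b \<otimes>\<^bsub>H\<^esub> inv\<^bsub>H\<^esub> a \<otimes>\<^bsub>H\<^esub> inv\<^bsub>H\<^esub> b"

lemma (in group) commutator_eq_one_iff:
  assumes "a \<in> carrier G" "b \<in> carrier G"
  shows "commutator G a b = \<one> \<longleftrightarrow> a \<otimes> b = b \<otimes> a"
proof -
  have "commutator G a b = \<one> \<longleftrightarrow> (a \<otimes> b) \<otimes> inv (b \<otimes> a) = \<one>"
    using assms by (simp add: commutator_def inv_mult_group m_assoc)
  also have "\<dots> \<longleftrightarrow> a \<otimes> b = b \<otimes> a"
    using assms by (metis inv_closed m_closed inv_inv inv_equality r_inv)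
  finally show ?thesis .
qed

text \<open>Merges the two kinds of power relations, so that the exceptional generator with index 1
  is treated like the others.\<close>

definition F_exp :: "nat \<Rightarrow> int \<Rightarrow> nat \<Rightarrow> int"
  where "F_exp r t k = (if k = 1 then t else int r)"

locale F_group =
  fixes n r :: nat and t :: int
begin

abbreviation F where "F \<equiv> F_group n r t"

definition x where "x k = gen_class (F_gens n) (F_rels n r t) (GenX k)"
definition z where "z i j = gen_class (F_gens n) (F_rels n r t) (GenZ i j)"

sublocale F: group F
  unfolding F_group_def by (rule group_presented_group)

lemma GenX_in [simp]: "GenX k \<in> F_gens n \<longleftrightarrow> 1 \<le> k \<and> k \<le> n + 1"
  and GenZ_in [simp]: "GenZ i j \<in> F_gens n \<longleftrightarrow> 1 \<le> i \<and> i < j \<and> j \<le> n + 1"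
  by (auto simp: F_gens_def)

lemma x_closed [simp]: "1 \<le> k \<Longrightarrow> k \<le> n + 1 \<Longrightarrow> x k \<in> carrier F"
  by (simp add: x_def F_group_def)

lemma z_closed [simp]: "1 \<le> i \<Longrightarrow> i < j \<Longrightarrow> j \<le> n + 1 \<Longrightarrow> z i j \<in> carrier F"
  by (simp add: z_def F_group_def)

lemma gen_closed: "gen_class (F_gens n) (F_rels n r t) \<in> F_gens n \<rightarrow> carrier F"
  by (simp add: F_group_def)

lemma F_rel:
  assumes "(u, v) \<in> F_rels n r t"
  shows "word_val F (gen_class (F_gens n) (F_rels n r t)) u
    = word_val F (gen_class (F_gens n) (F_rels n r t)) v"
  unfolding F_group_def using F_rels_words[OF assms] by (intro presented_group_rel assms) auto

lemma comm_x:
  assumes "1 \<le> i" "i < j" "j \<le> n + 1"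
  shows "commutator F (x i) (x j) = z i j"
proof -
  have "(word_comm (letter (GenX i)) (letter (GenX j)), letter (GenZ i j)) \<in> F_rels n r t"
    using assms by (auto simp: F_rels_def)
  from F_rel[OF this] show ?thesis
    using assms by (simp add: F.word_val_comm[OF gen_closed] F.word_val_letter[OF gen_closed]
        commutator_def x_def z_def)
qed

lemma x_pow:
  assumes "1 \<le> k" "k \<le> n + 1"
  shows "x k [^]\<^bsub>F\<^esub> F_exp r t k = \<one>\<^bsub>F\<^esub>"
proof -
  have "(word_pow (letter (GenX k)) (F_exp r t k), []) \<in> F_rels n r t"
    using assms by (auto simp: F_rels_def F_exp_def)
  from F_rel[OF this] show ?thesis
    using assms by (simp add: F.word_val_pow[OF gen_closed] F.word_val_letter[OF gen_closed] x_def)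
qed

lemma z_comm_gen:
  assumes "1 \<le> i" "i < j" "j \<le> n + 1" "g \<in> F_gens n"
  shows "z i j \<otimes>\<^bsub>F\<^esub> gen_class (F_gens n) (F_rels n r t) g
    = gen_class (F_gens n) (F_rels n r t) g \<otimes>\<^bsub>F\<^esub> z i j"
proof -
  have "(word_comm (letter (GenZ i j)) (letter g), []) \<in> F_rels n r t"
    unfolding F_rels_def using assms by blast
  from F_rel[OF this] have "commutator F (z i j) (gen_class (F_gens n) (F_rels n r t) g) = \<one>\<^bsub>F\<^esub>"
    using assms by (simp add: F.word_val_comm[OF gen_closed] F.word_val_letter[OF gen_closed]
        commutator_def z_def)
  then show ?thesis
    using assms gen_closed by (subst (asm) F.commutator_eq_one_iff) auto
qed

text \<open>The \<open>z i j\<close> are commutators of the \<open>x k\<close> by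
  \<open>comm_x\<close>, so the \<open>x k\<close> alone generate \<open>F\<close>.\<close>

lemma F_hom_eqI:
  assumes "group H" "\<phi> \<in> hom F H" "\<psi> \<in> hom F H"
    and x: "\<And>k. 1 \<le> k \<Longrightarrow> k \<le> n + 1 \<Longrightarrow> \<phi> (x k) = \<psi> (x k)"
    and "a \<in> carrier F"
  shows "\<phi> a = \<psi> a"
proof -
  interpret \<phi>: group_hom F H \<phi>
    by (intro group_hom.intro group_hom_axioms.intro F.is_group assms)
  interpret \<psi>: group_hom F H \<psi>
    by (intro group_hom.intro group_hom_axioms.intro F.is_group assms)
  have z: "\<phi> (z i j) = \<psi> (z i j)" if ij: "1 \<le> i" "i < j" "j \<le> n + 1" for i j
    using ij by (simp add: comm_x[OF ij, symmetric] commutator_def x)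
  have "\<phi> (gen_class (F_gens n) (F_rels n r t) s) = \<psi> (gen_class (F_gens n) (F_rels n r t) s)"
    if "s \<in> F_gens n" for s
    using that x z by (auto simp: F_gens_def x_def z_def)
  then show ?thesis
    using assms hom_presented_group_eqI[of H \<phi> "F_gens n" "F_rels n r t" \<psi> a]
    by (simp add: F_group_def)
qed

text \<open>Following \<phi> by conjugation with \<open>h\<close> gives another homomorphism, which
  agrees with \<phi> on the \<open>x k\<close>; \<open>F_hom_eqI\<close> extends the agreement to
  \<open>F\<close> without an induction on words.\<close>

lemma F_hom_commute:
  assumes "group H" "\<phi> \<in> hom F H" and h: "h \<in> carrier H"
    and comm: "\<And>k. 1 \<le> k \<Longrightarrow> k \<le> n + 1 \<Longrightarrow> h \<otimes>\<^bsub>H\<^esub> \<phi> (x k) = \<phi> (x k) \<otimes>\<^bsub>H\<^esub> h"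
    and a: "a \<in> carrier F"
  shows "h \<otimes>\<^bsub>H\<^esub> \<phi> a = \<phi> a \<otimes>\<^bsub>H\<^esub> h"
proof -
  interpret \<phi>: group_hom F H \<phi>
    by (intro group_hom.intro group_hom_axioms.intro F.is_group assms)
  let ?c = "\<lambda>a. h \<otimes>\<^bsub>H\<^esub> \<phi> a \<otimes>\<^bsub>H\<^esub> inv\<^bsub>H\<^esub> h"
  have conj: "?c a = \<phi> a \<longleftrightarrow> h \<otimes>\<^bsub>H\<^esub> \<phi> a = \<phi> a \<otimes>\<^bsub>H\<^esub> h" if "a \<in> carrier F" for a
    by (rule \<phi>.inv_solve_right') (use that h in auto)
  have "inv\<^bsub>H\<^esub> h \<otimes>\<^bsub>H\<^esub> (h \<otimes>\<^bsub>H\<^esub> b) = b" if "b \<in> carrier H" for b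
    using h that by (simp flip: \<phi>.m_assoc)
  then have "?c \<in> hom F H"
    using h by (intro homI) (auto simp: \<phi>.m_assoc)
  moreover have "?c (x k) = \<phi> (x k)" if "1 \<le> k" "k \<le> n + 1" for k
    using conj[OF x_closed[OF that]] comm[OF that] by blast
  ultimately have "?c a = \<phi> a"
    using F_hom_eqI[OF assms(1) _ assms(2) _ a] by blast
  then show ?thesis using conj a by simp
qed

text \<open>The relations give commutation with generators only; \<open>F_hom_commute\<close> for
  the identity homomorphism extends it to all of \<open>F\<close>.\<close>

lemma z_central:
  assumes ij: "1 \<le> i" "i < j" "j \<le> n + 1" and a: "a \<in> carrier F"
  shows "z i j \<otimes>\<^bsub>F\<^esub> a = a \<otimes>\<^bsub>F\<^esub> z i j"
proof (rule F_hom_commute[of F "\<lambda>a. a", OF F.is_group _ z_closed[OF ij] _ a])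
  show "(\<lambda>a. a) \<in> hom F F"
    by (intro homI) auto
  show "z i j \<otimes>\<^bsub>F\<^esub> x k = x k \<otimes>\<^bsub>F\<^esub> z i j" if "1 \<le> k" "k \<le> n + 1" for k
    using that z_comm_gen[OF ij, of "GenX k"] by (simp add: x_def[symmetric])
qed

text \<open>Only the images of the \<open>x k\<close> are free: the commutator relations force the
  image of \<open>z i j\<close>, and the centrality relations are then covered by the hypothesis on
  commutators.\<close>

lemma F_hom_exists:
  assumes "group H"
    and y: "\<And>k. 1 \<le> k \<Longrightarrow> k \<le> n + 1 \<Longrightarrow> y k \<in> carrier H"
    and y_pow: "\<And>k. 1 \<le> k \<Longrightarrow> k \<le> n + 1 \<Longrightarrow> y k [^]\<^bsub>H\<^esub> F_exp r t k = \<one>\<^bsub>H\<^esub>"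
    and y_comm: "\<And>i j b. 1 \<le> i \<Longrightarrow> i < j \<Longrightarrow> j \<le> n + 1 \<Longrightarrow> b \<in> carrier H \<Longrightarrow>
      commutator H (y i) (y j) \<otimes>\<^bsub>H\<^esub> b = b \<otimes>\<^bsub>H\<^esub> commutator H (y i) (y j)"
  obtains \<phi> where "\<phi> \<in> hom F H" "\<And>k. 1 \<le> k \<Longrightarrow> k \<le> n + 1 \<Longrightarrow> \<phi> (x k) = y k"
proof -
  interpret H: group H by fact
  define h where "h g = (case g of GenX k \<Rightarrow> y k | GenZ i j \<Rightarrow> commutator H (y i) (y j))" for g
  have h: "h \<in> F_gens n \<rightarrow> carrier H"
    by (auto simp: F_gens_def h_def commutator_def y)
  note val = H.word_val_comm[OF h] H.word_val_pow[OF h] H.word_val_letter[OF h]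
  have comm: "commutator H (h (GenZ i j)) (h g) = \<one>\<^bsub>H\<^esub>"
    if ij: "1 \<le> i" "i < j" "j \<le> n + 1" and g: "g \<in> F_gens n" for i j g
  proof (subst H.commutator_eq_one_iff)
    show "h (GenZ i j) \<in> carrier H" "h g \<in> carrier H"
      by (rule funcset_mem[OF h], use ij g in simp)+
    then show "h (GenZ i j) \<otimes>\<^bsub>H\<^esub> h g = h g \<otimes>\<^bsub>H\<^esub> h (GenZ i j)"
      using y_comm[OF ij] by (simp add: h_def)
  qed
  have rel: "word_val H h u = word_val H h v" if uv: "(u, v) \<in> F_rels n r t" for u v
  proof -
    consider
      (comm) i j where "u = word_comm (letter (GenX i)) (letter (GenX j))" "v = letter (GenZ i j)"
        "1 \<le> i" "i < j" "j \<le> n + 1"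
    | (pow1) "u = word_pow (letter (GenX 1)) t" "v = []"
    | (pow) j where "u = word_pow (letter (GenX j)) (int r)" "v = []" "2 \<le> j" "j \<le> n + 1"
    | (central) i j g where "u = word_comm (letter (GenZ i j)) (letter g)" "v = []"
        "1 \<le> i" "i < j" "j \<le> n + 1" "g \<in> F_gens n"
      using uv unfolding F_rels_def by blast
    then show ?thesis
    proof cases
      case comm
      then show ?thesis by (simp add: val) (simp add: h_def commutator_def)
    next
      case pow1
      then show ?thesis using y_pow[of 1] by (simp add: val) (simp add: h_def F_exp_def)
    next
      case pow
      then show ?thesis using y_pow[of j] by (simp add: val) (simp add: h_def F_exp_def)
    next
      case central
      then show ?thesis using comm by (simp add: val commutator_def)
    qed
  qed
  obtain \<phi> where "\<phi> \<in> hom F H"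
    "\<And>s. s \<in> F_gens n \<Longrightarrow> \<phi> (gen_class (F_gens n) (F_rels n r t) s) = h s"
    using presented_group_hom_exists[OF assms(1) h rel] unfolding F_group_def by blast
  then show ?thesis
    using that by (simp add: x_def h_def)
qed

end


section \<open>The abelian quotient\<close>

text \<open>Division with remainder. For \<open>m = 0\<close> the remainder is \<open>a\<close>
  itself, so infinite cyclic factors are included.\<close>

lemma (in group) int_pow_mod:
  fixes a m :: int
  assumes "q \<in> carrier G" "q [^] m = \<one>"
  shows "q [^] (a mod m) = q [^] a"
proof -
  have "q [^] a = q [^] (m * (a div m)) \<otimes> q [^] (a mod m)"
    using assms(1) by (simp flip: int_pow_mult)
  then show ?thesis
    using assms by (simp flip: int_pow_pow)
qed

context F_group
begin

section \<open>Coordinates on the direct sum of cyclic groups\<close>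

definition G where
  "G = product_group {1..n} (\<lambda>_. integer_mod_group r) \<times>\<times> integer_mod_group (nat \<bar>t\<bar>)"

text \<open>The order of the \<open>k\<close>-th cyclic factor, with 0 standing for an infinite
  factor; the absolute value takes care of a negative \<open>t\<close>.\<close>

definition ord where "ord k = nat \<bar>F_exp r t k\<bar>"

text \<open>Numbers the factors like the generators of \<open>F\<close>: coordinate 1 is the factor
  belonging to \<open>t\<close>, stored as the second component, and coordinates 2 to n+1 are the
  entries 1 to n of the first component.\<close>

definition coord :: "(nat \<Rightarrow> int) \<times> int \<Rightarrow> nat \<Rightarrow> int"
  where "coord g k = (if k = 1 then snd g else fst g (k - 1))"

definition of_coords :: "(nat \<Rightarrow> int) \<Rightarrow> (nat \<Rightarrow> int) \<times> int"
  where "of_coords v = ((\<lambda>i\<in>{1..n}. v (i + 1)), v 1)"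

sublocale G: comm_group G
proof (rule group.group_comm_groupI)
  show "group G"
    unfolding G_def by (intro DirProd_group product_group) simp_all
  show "g \<otimes>\<^bsub>G\<^esub> h = h \<otimes>\<^bsub>G\<^esub> g" if "g \<in> carrier G" "h \<in> carrier G" for g h
    using that by (auto simp: G_def mult_DirProd' add.commute intro!: restrict_ext)
qed

lemma ord_simps: "ord (Suc 0) = nat \<bar>t\<bar>" "k \<noteq> Suc 0 \<Longrightarrow> ord k = r"
  by (auto simp: ord_def F_exp_def)

lemma coord_closed:
  assumes "g \<in> carrier G" "1 \<le> k" "k \<le> n + 1"
  shows "coord g k \<in> carrier (integer_mod_group (ord k))"
proof (cases "k = 1")
  case False
  then have "k - 1 \<in> {1..n}" using assms by auto
  then have "fst g (k - 1) \<in> carrier (integer_mod_group r)"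
    using assms(1) unfolding G_def by (auto simp: PiE_iff simp del: atLeastAtMost_iff)
  then show ?thesis using False by (simp add: coord_def ord_simps)
qed (use assms(1) in \<open>auto simp: G_def coord_def ord_simps\<close>)

lemma coord_mult:
  "g \<in> carrier G \<Longrightarrow> h \<in> carrier G \<Longrightarrow> 1 \<le> k \<Longrightarrow> k \<le> n + 1 \<Longrightarrow>
    coord (g \<otimes>\<^bsub>G\<^esub> h) k = (coord g k + coord h k) mod int (ord k)"
  by (auto simp: G_def coord_def ord_simps mult_DirProd')

lemma of_coords_closed:
  assumes "\<And>k. 1 \<le> k \<Longrightarrow> k \<le> n + 1 \<Longrightarrow> v k \<in> carrier (integer_mod_group (ord k))"
  shows "of_coords v \<in> carrier G"
proof -
  have "v (i + 1) \<in> carrier (integer_mod_group r)" if "i \<in> {1..n}" for i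
    using assms[of "i + 1"] that by (simp add: ord_simps)
  then show ?thesis
    using assms[of 1] by (auto simp: G_def of_coords_def ord_simps)
qed

lemma coord_of_coords: "1 \<le> k \<Longrightarrow> k \<le> n + 1 \<Longrightarrow> coord (of_coords v) k = v k"
  by (auto simp: coord_def of_coords_def)

lemma G_eqI:
  assumes "g \<in> carrier G" "h \<in> carrier G"
    and "\<And>k. 1 \<le> k \<Longrightarrow> k \<le> n + 1 \<Longrightarrow> coord g k = coord h k"
  shows "g = h"
proof (rule prod_eqI)
  show "snd g = snd h"
    using assms(3)[of 1] by (simp add: coord_def)
  show "fst g = fst h"
  proof (rule PiE_ext)
    show "fst g \<in> {1..n} \<rightarrow>\<^sub>E carrier (integer_mod_group r)" "fst h \<in> {1..n} \<rightarrow>\<^sub>E carrier (integer_mod_group r)"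
      using assms(1,2) by (auto simp: G_def)
    show "fst g i = fst h i" if "i \<in> {1..n}" for i
      using assms(3)[of "i + 1"] that by (auto simp: coord_def)
  qed
qed

definition axis where "axis k a = of_coords (\<lambda>j. if j = k then a else 0)"

text \<open>The intended image of \<open>x k\<close>. Reducing 1 matters for a trivial factor, whose
  only representative is 0; for order 0 the reduction does nothing. For \<open>k\<close> outside 1
  to n+1 this is the identity of \<open>G\<close>.\<close>

definition e where "e k = axis k (1 mod int (ord k))"

lemma axis_closed [simp]: "a \<in> carrier (integer_mod_group (ord k)) \<Longrightarrow> axis k a \<in> carrier G"
  unfolding axis_def by (rule of_coords_closed) auto

lemma mod_closed: "a mod int m \<in> carrier (integer_mod_group m)"
  by (simp add: carrier_integer_mod_group)

lemma e_closed [simp]: "e k \<in> carrier G"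
  by (simp add: e_def mod_closed)

lemma coord_axis: "1 \<le> j \<Longrightarrow> j \<le> n + 1 \<Longrightarrow> coord (axis k a) j = (if j = k then a else 0)"
  by (simp add: axis_def coord_of_coords)

lemma axis_hom: "axis k \<in> hom (integer_mod_group (ord k)) G"
proof (rule homI)
  fix a b
  assume a: "a \<in> carrier (integer_mod_group (ord k))" and b: "b \<in> carrier (integer_mod_group (ord k))"
  then have "(a + b) mod int (ord k) \<in> carrier (integer_mod_group (ord k))"
    by (simp add: mod_closed)
  then show "axis k (a \<otimes>\<^bsub>integer_mod_group (ord k)\<^esub> b) = axis k a \<otimes>\<^bsub>G\<^esub> axis k b"
    using a b by (intro G_eqI) (simp_all add: coord_axis coord_mult)
qed simp

lemma e_pow: "e k [^]\<^bsub>G\<^esub> a = axis k (a mod int (ord k))" for a :: int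
proof -
  interpret i: group_hom "integer_mod_group (ord k)" G "axis k"
    by (intro group_hom.intro group_hom_axioms.intro axis_hom G.is_group) simp
  show ?thesis
    unfolding e_def using i.hom_int_pow[OF mod_closed, of 1 a]
    by (simp add: int_pow_integer_mod_group mod_mult_right_eq)
qed

lemma e_order: "e k [^]\<^bsub>G\<^esub> F_exp r t k = \<one>\<^bsub>G\<^esub>"
proof -
  interpret i: group_hom "integer_mod_group (ord k)" G "axis k"
    by (intro group_hom.intro group_hom_axioms.intro axis_hom G.is_group) simp
  \<comment> \<open>This holds for either sign of the exponent, and for exponent 0 because
    \<open>0 mod 0\<close> is 0.\<close>
  have "F_exp r t k mod int (ord k) = 0"
    by (simp add: ord_def)
  then show ?thesis
    using i.hom_one by (simp add: e_pow)
qed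

text \<open>Build \<open>g\<close> one coordinate at a time: the truncation \<open>s m\<close> keeps
  the first \<open>m\<close> coordinates, and consecutive truncations differ by a power of one
  \<open>e k\<close>.\<close>

lemma e_generate:
  assumes K: "subgroup K G" and e: "\<And>k. 1 \<le> k \<Longrightarrow> k \<le> n + 1 \<Longrightarrow> e k \<in> K"
  shows "carrier G \<subseteq> K"
proof
  fix g assume g: "g \<in> carrier G"
  interpret K: subgroup K G by fact
  have axis: "axis k a \<in> K" if "1 \<le> k" "k \<le> n + 1" "a \<in> carrier (integer_mod_group (ord k))" for k a
  proof -
    have "e k [^]\<^bsub>G\<^esub> a \<in> K"
      using K e that by (intro G.subgroup_int_pow_closed) auto
    moreover have "a mod int (ord k) = a"
      using that by (cases "ord k = 0") (auto simp: carrier_integer_mod_group)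
    ultimately show ?thesis by (simp add: e_pow)
  qed
  define s where "s m = of_coords (\<lambda>j. if j \<le> m then coord g j else 0)" for m
  have s: "s m \<in> carrier G" for m
    unfolding s_def using coord_closed[OF g] by (intro of_coords_closed) auto
  have s_coord: "coord (s m) j = (if j \<le> m then coord g j else 0)" if "1 \<le> j" "j \<le> n + 1" for m j
    unfolding s_def using that by (rule coord_of_coords)
  have "s m \<in> K" if "m \<le> n + 1" for m
    using that
  proof (induction m)
    case 0
    \<comment> \<open>The identity of \<open>G\<close>, written as an axis element so that the fact
      \<open>axis\<close> gives membership.\<close>
    have "s 0 = axis 1 0"
      by (intro G_eqI s) (auto simp: s_coord coord_axis)
    then show ?case using axis[of 1 0] by simp
  next
    case (Suc m)
    have a: "coord g (Suc m) \<in> carrier (integer_mod_group (ord (Suc m)))"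
      using coord_closed[OF g, of "Suc m"] Suc.prems by simp
    have mod: "coord g j mod int (ord j) = coord g j" if "1 \<le> j" "j \<le> n + 1" for j
      using coord_closed[OF g that] by (cases "ord j = 0") (auto simp: carrier_integer_mod_group)
    have "s (Suc m) = s m \<otimes>\<^bsub>G\<^esub> axis (Suc m) (coord g (Suc m))"
    proof (rule G_eqI)
      fix j assume j: "1 \<le> j" "j \<le> n + 1"
      then show "coord (s (Suc m)) j = coord (s m \<otimes>\<^bsub>G\<^esub> axis (Suc m) (coord g (Suc m))) j"
        using mod[OF j] s a by (cases "j = Suc m") (simp_all add: s_coord coord_axis coord_mult le_Suc_eq)
    qed (use s a in auto)
    then show ?case using Suc axis[OF _ _ a] by simp
  qed
  then have "s (n + 1) \<in> K" by simp
  also have "s (n + 1) = g"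
    by (intro G_eqI s g) (simp add: s_coord)
  finally show "g \<in> K" .
qed

text \<open>Send \<open>g\<close> to the product of the \<open>q k\<close> raised to the coordinates
  of \<open>g\<close>. Coordinates add only modulo \<open>ord k\<close>, which is harmless because
  \<open>q k\<close> to the power \<open>ord k\<close> is trivial.\<close>

lemma G_hom_exists:
  assumes "comm_group Q"
    and q: "\<And>k. 1 \<le> k \<Longrightarrow> k \<le> n + 1 \<Longrightarrow> q k \<in> carrier Q"
    and q_pow: "\<And>k. 1 \<le> k \<Longrightarrow> k \<le> n + 1 \<Longrightarrow> q k [^]\<^bsub>Q\<^esub> F_exp r t k = \<one>\<^bsub>Q\<^esub>"
  obtains \<psi> where "\<psi> \<in> hom G Q" "\<And>k. 1 \<le> k \<Longrightarrow> k \<le> n + 1 \<Longrightarrow> \<psi> (e k) = q k"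
proof -
  interpret Q: comm_group Q by fact
  have pow_ord: "q k [^]\<^bsub>Q\<^esub> (a mod int (ord k)) = q k [^]\<^bsub>Q\<^esub> a" if "1 \<le> k" "k \<le> n + 1" for k a
  proof -
    \<comment> \<open>\<open>ord k\<close> is the absolute value of \<open>F_exp r t k\<close>, so
      for a negative \<open>t\<close> the exponent changes sign.\<close>
    have "q k [^]\<^bsub>Q\<^esub> int (ord k) = \<one>\<^bsub>Q\<^esub>"
      using q[OF that] q_pow[OF that] by (auto simp: ord_def abs_if Q.int_pow_neg)
    then show ?thesis by (rule Q.int_pow_mod[OF q[OF that]])
  qed
  define \<psi> where "\<psi> g = finprod Q (\<lambda>k. q k [^]\<^bsub>Q\<^esub> coord g k) {1..n+1}" for g
  show ?thesis
  proof
    show "\<psi> \<in> hom G Q"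
    proof (rule homI)
      fix g h assume g: "g \<in> carrier G" and h: "h \<in> carrier G"
      have "\<psi> (g \<otimes>\<^bsub>G\<^esub> h) = finprod Q (\<lambda>k. q k [^]\<^bsub>Q\<^esub> coord g k \<otimes>\<^bsub>Q\<^esub> q k [^]\<^bsub>Q\<^esub> coord h k) {1..n+1}"
        unfolding \<psi>_def using g h q
        by (intro Q.finprod_cong') (auto simp: coord_mult pow_ord Q.int_pow_mult)
      also have "\<dots> = \<psi> g \<otimes>\<^bsub>Q\<^esub> \<psi> h"
        unfolding \<psi>_def using q by (intro Q.finprod_multf) auto
      finally show "\<psi> (g \<otimes>\<^bsub>G\<^esub> h) = \<psi> g \<otimes>\<^bsub>Q\<^esub> \<psi> h" .
    qed (use q in \<open>auto simp: \<psi>_def intro!: Q.finprod_closed\<close>)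
    show "\<psi> (e k) = q k" if k: "1 \<le> k" "k \<le> n + 1" for k
    proof -
      have "\<psi> (e k) = finprod Q (\<lambda>j. if k = j then q j else \<one>\<^bsub>Q\<^esub>) {1..n+1}"
        unfolding \<psi>_def using q by (intro Q.finprod_cong') (auto simp: e_def coord_axis pow_ord)
      also have "\<dots> = q k"
        using k q by (intro Q.finprod_singleton) auto
      finally show ?thesis .
    qed
  qed
qed

section \<open>The projection from \<open>F\<close> to \<open>G\<close> and its kernel\<close>

lemma pi_exists: "\<exists>\<pi>. \<pi> \<in> hom F G \<and> (\<forall>k. 1 \<le> k \<longrightarrow> k \<le> n + 1 \<longrightarrow> \<pi> (x k) = e k)"
proof -
  have "commutator G (e i) (e j) = \<one>\<^bsub>G\<^esub>" for i j
    by (subst G.commutator_eq_one_iff) (simp_all add: G.m_comm)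
  then have "commutator G (e i) (e j) \<otimes>\<^bsub>G\<^esub> b = b \<otimes>\<^bsub>G\<^esub> commutator G (e i) (e j)"
    if "b \<in> carrier G" for i j b
    using that by simp
  then obtain \<pi> where "\<pi> \<in> hom F G" "\<And>k. 1 \<le> k \<Longrightarrow> k \<le> n + 1 \<Longrightarrow> \<pi> (x k) = e k"
    using F_hom_exists[of G e, OF G.is_group e_closed e_order] by blast
  then show ?thesis by blast
qed

text \<open>A fixed witness of \<open>pi_exists\<close>; by \<open>F_hom_eqI\<close> its values on
  \<open>F\<close> are determined.\<close>

definition \<pi> where
  "\<pi> = (SOME \<pi>. \<pi> \<in> hom F G \<and> (\<forall>k. 1 \<le> k \<longrightarrow> k \<le> n + 1 \<longrightarrow> \<pi> (x k) = e k))"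

lemma pi_hom: "\<pi> \<in> hom F G" and pi_x: "1 \<le> k \<Longrightarrow> k \<le> n + 1 \<Longrightarrow> \<pi> (x k) = e k"
proof -
  have "\<pi> \<in> hom F G \<and> (\<forall>k. 1 \<le> k \<longrightarrow> k \<le> n + 1 \<longrightarrow> \<pi> (x k) = e k)"
    unfolding \<pi>_def by (rule someI_ex[OF pi_exists])
  then show "\<pi> \<in> hom F G" "1 \<le> k \<Longrightarrow> k \<le> n + 1 \<Longrightarrow> \<pi> (x k) = e k" by blast+
qed

sublocale \<pi>: group_hom F G \<pi>
  by (intro group_hom.intro group_hom_axioms.intro F.is_group G.is_group pi_hom)

lemma pi_surj: "\<pi> ` carrier F = carrier G"
proof
  show "carrier G \<subseteq> \<pi> ` carrier F"
    by (rule e_generate[OF \<pi>.img_is_subgroup]) (metis pi_x x_closed imageI)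
qed auto

definition Z where "Z = generate F {z i j | i j. 1 \<le> i \<and> i < j \<and> j \<le> n + 1}"

lemma Z_subgroup: "subgroup Z F"
  unfolding Z_def by (rule F.generate_is_subgroup) auto

text \<open>The centralizer of \<open>a\<close> is a subgroup, and it contains the generators
  \<open>z i j\<close> of \<open>Z\<close>.\<close>

lemma Z_central:
  assumes "c \<in> Z" "a \<in> carrier F"
  shows "c \<otimes>\<^bsub>F\<^esub> a = a \<otimes>\<^bsub>F\<^esub> c"
proof -
  have "subgroup {c \<in> carrier F. c \<otimes>\<^bsub>F\<^esub> a = a \<otimes>\<^bsub>F\<^esub> c} F"
  proof (rule F.subgroupI)
    fix c assume "c \<in> {c \<in> carrier F. c \<otimes>\<^bsub>F\<^esub> a = a \<otimes>\<^bsub>F\<^esub> c}"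
    then have c: "c \<in> carrier F" "c \<otimes>\<^bsub>F\<^esub> a = a \<otimes>\<^bsub>F\<^esub> c" by auto
    have "inv\<^bsub>F\<^esub> c \<otimes>\<^bsub>F\<^esub> a = inv\<^bsub>F\<^esub> c \<otimes>\<^bsub>F\<^esub> (a \<otimes>\<^bsub>F\<^esub> c) \<otimes>\<^bsub>F\<^esub> inv\<^bsub>F\<^esub> c"
      using c(1) assms(2) by (simp add: F.m_assoc)
    also have "\<dots> = a \<otimes>\<^bsub>F\<^esub> inv\<^bsub>F\<^esub> c"
      using c(1) assms(2) by (simp flip: c(2) F.m_assoc)
    finally show "inv\<^bsub>F\<^esub> c \<in> {c \<in> carrier F. c \<otimes>\<^bsub>F\<^esub> a = a \<otimes>\<^bsub>F\<^esub> c}"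
      using c by simp
  next
    fix c d assume "c \<in> {c \<in> carrier F. c \<otimes>\<^bsub>F\<^esub> a = a \<otimes>\<^bsub>F\<^esub> c}" "d \<in> {c \<in> carrier F. c \<otimes>\<^bsub>F\<^esub> a = a \<otimes>\<^bsub>F\<^esub> c}"
    then have c: "c \<in> carrier F" "c \<otimes>\<^bsub>F\<^esub> a = a \<otimes>\<^bsub>F\<^esub> c" and d: "d \<in> carrier F" "d \<otimes>\<^bsub>F\<^esub> a = a \<otimes>\<^bsub>F\<^esub> d" by auto
    have "c \<otimes>\<^bsub>F\<^esub> d \<otimes>\<^bsub>F\<^esub> a = c \<otimes>\<^bsub>F\<^esub> a \<otimes>\<^bsub>F\<^esub> d"
      using c(1) d assms(2) by (simp add: F.m_assoc)
    then have "c \<otimes>\<^bsub>F\<^esub> d \<otimes>\<^bsub>F\<^esub> a = a \<otimes>\<^bsub>F\<^esub> (c \<otimes>\<^bsub>F\<^esub> d)"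
      using c d assms(2) by (simp add: F.m_assoc)
    then show "c \<otimes>\<^bsub>F\<^esub> d \<in> {c \<in> carrier F. c \<otimes>\<^bsub>F\<^esub> a = a \<otimes>\<^bsub>F\<^esub> c}"
      using c d by simp
  qed (use assms(2) in auto)
  then have "Z \<subseteq> {c \<in> carrier F. c \<otimes>\<^bsub>F\<^esub> a = a \<otimes>\<^bsub>F\<^esub> c}"
    unfolding Z_def using assms(2) z_central by (intro F.generate_subgroup_incl) auto
  then show ?thesis using assms(1) by auto
qed

lemma Z_derived: "Z \<subseteq> derived F (carrier F)"
  unfolding Z_def derived_def
proof (rule F.mono_generate, clarify)
  fix i j assume ij: "1 \<le> i" "i < j" "j \<le> n + 1"
  then have "z i j = x i \<otimes>\<^bsub>F\<^esub> x j \<otimes>\<^bsub>F\<^esub> inv\<^bsub>F\<^esub> x i \<otimes>\<^bsub>F\<^esub> inv\<^bsub>F\<^esub> x j" "x i \<in> carrier F" "x j \<in> carrier F"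
    by (simp_all add: commutator_def flip: comm_x)
  then show "z i j \<in> (\<Union>a\<in>carrier F. \<Union>b\<in>carrier F. {a \<otimes>\<^bsub>F\<^esub> b \<otimes>\<^bsub>F\<^esub> inv\<^bsub>F\<^esub> a \<otimes>\<^bsub>F\<^esub> inv\<^bsub>F\<^esub> b})"
    by blast
qed

lemma Z_normal: "Z \<lhd> F"
proof (rule F.normal_inv_iff[THEN iffD2], intro conjI ballI)
  show "subgroup Z F" by (rule Z_subgroup)
  show "a \<otimes>\<^bsub>F\<^esub> c \<otimes>\<^bsub>F\<^esub> inv\<^bsub>F\<^esub> a \<in> Z" if "a \<in> carrier F" "c \<in> Z" for a c
    using that subgroup.mem_carrier[OF Z_subgroup that(2)] Z_central[OF that(2,1), symmetric]
    by (simp add: F.m_assoc)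
qed

text \<open>\<open>F/Z\<close> is abelian, so by the universal property of \<open>G\<close> the projection \<open>F \<rightarrow> F/Z\<close> factors
  through \<open>\<pi>\<close>.\<close>

lemma kernel_pi: "kernel F G \<pi> = Z"
proof
  have "\<pi> (z i j) = \<one>\<^bsub>G\<^esub>" if ij: "1 \<le> i" "i < j" "j \<le> n + 1" for i j
  proof -
    have "\<pi> (z i j) = commutator G (\<pi> (x i)) (\<pi> (x j))"
      using ij by (simp add: comm_x[OF ij, symmetric] commutator_def)
    also have "\<dots> = \<one>\<^bsub>G\<^esub>"
      using ij by (subst G.commutator_eq_one_iff) (simp_all add: G.m_comm)
    finally show ?thesis .
  qed
  then show "Z \<subseteq> kernel F G \<pi>"
    unfolding Z_def by (intro F.generate_subgroup_incl \<pi>.subgroup_kernel) (auto simp: kernel_def)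
next
  interpret Z: normal Z F by (rule Z_normal)
  interpret Q: group "F Mod Z" by (rule Z.factorgroup_is_group)
  let ?p = "\<lambda>a. Z #>\<^bsub>F\<^esub> a"
  have p: "?p \<in> hom F (F Mod Z)" by (rule Z.r_coset_hom_Mod)
  interpret p: group_hom F "F Mod Z" ?p
    by (intro group_hom.intro group_hom_axioms.intro F.is_group Q.is_group p)
  have p_z: "?p c = \<one>\<^bsub>F Mod Z\<^esub>" if "c \<in> Z" for c
    using that F.coset_join2[OF _ Z_subgroup] Z.mem_carrier by simp
  \<comment> \<open>The commutator maps to the coset of \<open>z i j\<close>, which is trivial.
    Since \<open>z i j\<close> is a generator only for \<open>i < j\<close>, the remaining cases
    follow by symmetry in \<open>comm_gen\<close>.\<close>
  have lt: "?p (x i) \<otimes>\<^bsub>F Mod Z\<^esub> ?p (x j) = ?p (x j) \<otimes>\<^bsub>F Mod Z\<^esub> ?p (x i)"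
    if ij: "1 \<le> i" "i < j" "j \<le> n + 1" for i j
  proof -
    have "commutator (F Mod Z) (?p (x i)) (?p (x j)) = ?p (z i j)"
      using ij by (simp add: comm_x[OF ij, symmetric] commutator_def del: mult_FactGroup)
    also have "\<dots> = \<one>\<^bsub>F Mod Z\<^esub>"
      using ij by (intro p_z) (auto simp: Z_def intro!: generate.incl)
    finally show ?thesis
      using ij by (subst (asm) Q.commutator_eq_one_iff) (auto simp del: mult_FactGroup)
  qed
  have comm_gen: "?p (x i) \<otimes>\<^bsub>F Mod Z\<^esub> ?p (x j) = ?p (x j) \<otimes>\<^bsub>F Mod Z\<^esub> ?p (x i)"
    if "1 \<le> i" "i \<le> n + 1" "1 \<le> j" "j \<le> n + 1" for i j
    using lt[of i j] lt[of j i] that by (cases i j rule: linorder_cases) auto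
  \<comment> \<open>From generators to all of \<open>F\<close> in two passes of
    \<open>F_hom_commute\<close>, one for each argument.\<close>
  have comm1: "?p (x i) \<otimes>\<^bsub>F Mod Z\<^esub> ?p a = ?p a \<otimes>\<^bsub>F Mod Z\<^esub> ?p (x i)"
    if "1 \<le> i" "i \<le> n + 1" "a \<in> carrier F" for i a
    by (rule F_hom_commute[OF Q.is_group p p.hom_closed[OF x_closed[OF that(1,2)]] comm_gen[OF that(1,2)] that(3)])
  have comm2: "?p b \<otimes>\<^bsub>F Mod Z\<^esub> ?p a = ?p a \<otimes>\<^bsub>F Mod Z\<^esub> ?p b"
    if "a \<in> carrier F" "b \<in> carrier F" for a b
    by (rule F_hom_commute[OF Q.is_group p p.hom_closed[OF that(2)] comm1[OF _ _ that(2), symmetric] that(1)])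
  have "comm_group (F Mod Z)"
  proof (rule Q.group_comm_groupI)
    fix C D assume "C \<in> carrier (F Mod Z)" "D \<in> carrier (F Mod Z)"
    then show "C \<otimes>\<^bsub>F Mod Z\<^esub> D = D \<otimes>\<^bsub>F Mod Z\<^esub> C"
      using comm2 by (auto simp: carrier_FactGroup simp del: mult_FactGroup)
  qed
  then obtain \<psi> where \<psi>: "\<psi> \<in> hom G (F Mod Z)"
    and \<psi>_e: "\<And>k. 1 \<le> k \<Longrightarrow> k \<le> n + 1 \<Longrightarrow> \<psi> (e k) = ?p (x k)"
  proof (rule G_hom_exists[where q = "\<lambda>k. ?p (x k)"])
    show "?p (x k) [^]\<^bsub>F Mod Z\<^esub> F_exp r t k = \<one>\<^bsub>F Mod Z\<^esub>" if "1 \<le> k" "k \<le> n + 1" for k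
      using p.hom_int_pow[of "x k" "F_exp r t k"] that by (simp add: x_pow)
  qed auto
  show "kernel F G \<pi> \<subseteq> Z"
  proof
    fix a assume "a \<in> kernel F G \<pi>"
    then have a: "a \<in> carrier F" "\<pi> a = \<one>\<^bsub>G\<^esub>" by (auto simp: kernel_def)
    \<comment> \<open>The composite of \<psi> with \<pi> agrees with the quotient map on the
      \<open>x k\<close>, hence on \<open>F\<close>, so the kernel of \<pi> lies in that of the
      quotient map.\<close>
    have "?p a = (\<psi> \<circ> \<pi>) a"
      by (rule F_hom_eqI[OF Q.is_group p hom_compose[OF pi_hom \<psi>] _ a(1)]) (simp add: pi_x \<psi>_e)
    also have "\<dots> = Z"
      using hom_one[OF \<psi> G.is_group Q.is_group] a by simp
    finally show "a \<in> Z"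
      using F.rcos_self[OF a(1) Z_subgroup] by simp
  qed
qed

text \<open>By \<open>lift_same_order\<close> each \<open>e k\<close> lifts to an element satisfying
  the power relation of \<open>x k\<close>. Commutators of lifts lie over the identity because
  \<open>G\<close> is abelian, so \<open>twisted_central\<close> makes them central.\<close>

lemma F_hom_twisted_exists:
  fixes M :: "('m, 'c) monoid_scheme"
  assumes "comm_group M" and \<alpha>: "\<alpha> \<in> cocycles2 G M"
    and div: "\<And>b m :: int. b \<in> carrier M \<Longrightarrow> m \<noteq> 0 \<Longrightarrow> \<exists>c\<in>carrier M. c [^]\<^bsub>M\<^esub> m = b"
  shows "\<exists>\<phi>\<in>hom F (twisted_product G M \<alpha>). \<forall>a\<in>carrier F. snd (\<phi> a) = \<pi> a"
proof -
  interpret M: comm_group M by fact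
  interpret \<alpha>: cocycle G M \<alpha>
    by unfold_locales (rule \<alpha>)
  interpret T: group \<alpha>.T by (rule \<alpha>.group_twisted_product)
  interpret p: group_hom \<alpha>.T G snd
    by (intro group_hom.intro group_hom_axioms.intro T.is_group G.is_group \<alpha>.snd_hom_twisted)
  have "\<exists>y. y \<in> carrier \<alpha>.T \<and> snd y = e k \<and> y [^]\<^bsub>\<alpha>.T\<^esub> F_exp r t k = \<one>\<^bsub>\<alpha>.T\<^esub>" for k
    using \<alpha>.lift_same_order[OF div e_closed e_order] by metis
  then obtain y where y: "\<And>k. y k \<in> carrier \<alpha>.T" "\<And>k. snd (y k) = e k"
    "\<And>k. y k [^]\<^bsub>\<alpha>.T\<^esub> F_exp r t k = \<one>\<^bsub>\<alpha>.T\<^esub>"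
    by metis
  have comm: "commutator \<alpha>.T (y i) (y j) \<otimes>\<^bsub>\<alpha>.T\<^esub> b = b \<otimes>\<^bsub>\<alpha>.T\<^esub> commutator \<alpha>.T (y i) (y j)"
    if "b \<in> carrier \<alpha>.T" for i j b
  proof (rule \<alpha>.twisted_central)
    have "snd (commutator \<alpha>.T (y i) (y j)) = commutator G (e i) (e j)"
      using y by (simp add: commutator_def)
    also have "\<dots> = \<one>\<^bsub>G\<^esub>"
      by (subst G.commutator_eq_one_iff) (simp_all add: G.m_comm)
    finally show "snd (commutator \<alpha>.T (y i) (y j)) = \<one>\<^bsub>G\<^esub>" .
  qed (use y that in \<open>simp_all add: commutator_def\<close>)
  obtain \<phi> where \<phi>: "\<phi> \<in> hom F \<alpha>.T" and \<phi>_x: "\<And>k. 1 \<le> k \<Longrightarrow> k \<le> n + 1 \<Longrightarrow> \<phi> (x k) = y k"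
    using F_hom_exists[of \<alpha>.T y, OF T.is_group y(1) y(3) comm] by blast
  have "(snd \<circ> \<phi>) a = \<pi> a" if "a \<in> carrier F" for a
    by (rule F_hom_eqI[OF G.is_group hom_compose[OF \<phi> \<alpha>.snd_hom_twisted] pi_hom _ that])
      (simp add: \<phi>_x y pi_x)
  then show ?thesis using \<phi> by auto
qed

lemma central_extension_F: "central_extension (F\<lparr>carrier := Z\<rparr>) (\<lambda>a. a) F \<pi> G"
proof -
  have "group (F\<lparr>carrier := Z\<rparr>)"
    by (rule subgroup.subgroup_is_group[OF Z_subgroup F.is_group])
  moreover have "(\<lambda>a. a) \<in> mon (F\<lparr>carrier := Z\<rparr>) F"
    using subgroup.subset[OF Z_subgroup] by (auto simp: mon_def hom_def)
  moreover have "\<pi> \<in> epi F G"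
    by (simp add: epi_def pi_hom pi_surj)
  moreover have "\<forall>c\<in>Z. \<forall>a\<in>carrier F. c \<otimes>\<^bsub>F\<^esub> a = a \<otimes>\<^bsub>F\<^esub> c"
    using Z_central by blast
  ultimately show ?thesis
    by (simp add: central_extension_def F.is_group G.is_group kernel_pi)
qed

end

section \<open>Divisibility of the multiplicative group of complex numbers\<close>

lemma nat_pow_complex_units: "c [^]\<^bsub>complex_units\<^esub> (m :: nat) = c ^ m"
  by (induction m) (simp_all add: complex_units_def mult.commute)

lemma complex_units_divisible:
  fixes m :: int
  assumes b: "b \<in> carrier complex_units" and "m \<noteq> 0"
  shows "\<exists>c\<in>carrier complex_units. c [^]\<^bsub>complex_units\<^esub> m = b"
proof -
  interpret U: comm_group complex_units by (rule comm_group_complex_units)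
  have root: "\<exists>c\<in>carrier complex_units. c [^]\<^bsub>complex_units\<^esub> int k = b"
    if "0 < k" "b \<in> carrier complex_units" for k b
  proof -
    \<comment> \<open>A \<open>k\<close>-th root in polar form: root of the modulus, argument
      divided by \<open>k\<close>.\<close>
    define c where "c = rcis (root k (cmod b)) (Arg b / real k)"
    have "c ^ k = b"
      using that by (simp add: c_def DeMoivre2 rcis_cmod_Arg)
    moreover from this have "c \<in> carrier complex_units"
      using that by (auto simp: complex_units_def)
    ultimately show ?thesis
      by (auto simp: int_pow_int nat_pow_complex_units)
  qed
  show ?thesis
  proof (cases "0 < m")
    case True
    then show ?thesis using root[of "nat m" b] b by simp
  next
    case False
    \<comment> \<open>For negative \<open>m\<close>, take a root of the inverse of \<open>b\<close>
      for the exponent \<open>- m\<close>; inverting that equation gives the power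
      \<open>m\<close>.\<close>
    then obtain c where "c \<in> carrier complex_units" "c [^]\<^bsub>complex_units\<^esub> (- m) = inv\<^bsub>complex_units\<^esub> b"
      using root[of "nat (- m)" "inv\<^bsub>complex_units\<^esub> b"] b \<open>m \<noteq> 0\<close> by auto
    then show ?thesis
      using b by (intro bexI[of _ c]) (auto simp: U.int_pow_neg U.inv_eq_1_iff intro: U.inv_inv)
  qed
qed

theorem theorem1p4:
  fixes n r :: nat and t :: int
  assumes "1 \<le> n" and "t dvd int r"
  shows "representation_group (F_group n r t)
    (product_group {1..n} (\<lambda>_. integer_mod_group r) \<times>\<times> integer_mod_group (nat \<bar>t\<bar>))"
proof -
  interpret F_group n r t .
  let ?A = "F\<lparr>carrier := Z\<rparr>"
  \<comment> \<open>The isomorphism is required for every section, so \<mu> stays arbitrary.\<close>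
  have "transgression ?A (\<lambda>a. a) F G complex_units \<mu> \<in> iso (hom_group ?A complex_units) (H2 G complex_units)"
    if \<mu>: "is_section F \<pi> G \<mu>" for \<mu>
  proof -
    interpret sectioned_central_extension ?A "\<lambda>a. a" F \<pi> G complex_units \<mu>
      by (intro sectioned_central_extension.intro sectioned_central_extension_axioms.intro
          comm_group_complex_units central_extension_F \<mu>)
    show ?thesis
      using Z_derived
      by (intro transgression_iso F_hom_twisted_exists comm_group_complex_units complex_units_divisible) auto
  qed
  then show ?thesis
    unfolding representation_group_def G_def[symmetric] using central_extension_F by blast
qed

end
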